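(* Let $K$ be a field and let $n,m,s,t$ be positive integers such that $1<m$ and $1<n$. Then there is a unital injective homomorphism of $K$-algebras $$\mathbb{M}_s(L_K(1,m))\longrightarrow \mathbb{M}_t(L_K(1,n))$$ if and only if there exist positive integers $k$ and $k'$ such that $(m-1)k=(n-1)k'$ and $ks\equiv t \pmod{n-1}$.
   Context: For an integer $n>1$ and a field $K$, the Leavitt algebra $L_K(1,n)$ is the unital associative $K$-algebra generated by $x_1,\dots,x_n,x_1^*,\dots,x_n^*$ subject to the relations $\sum_{i=1}^n x_ix_i^*=1$ and $x_i^*x_j=\delta_{ij}1$ for $1\le i,j\le n$. $\mathbb{M}_s(R)$ denotes the ring of $s\times s$ matrices over $R$. *)

theory Defs
  imports
    "Jordan_Normal_Form.Matrix"
    "HOL-Library.Poly_Mapping"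
    "HOL-Library.Cardinality"
    "HOL-Number_Theory.Cong"
begin

text \<open>
  The free algebra: generators are indexed by a type \<open>'n\<close>; for finite \<open>'n\<close> with \<open>n = CARD('n)\<close> elements these
  are the symbols $x_1,\dots,x_n,x_1^*,\dots,x_n^*$.  Words are a copy of lists, written additively,
  because the convolution product of \<^theory>\<open>HOL-Library.Poly_Mapping\<close> expects an additive (not
  necessarily commutative) monoid of exponents.
\<close>

datatype 'n symbol = Sym 'n | SymStar 'n

datatype 'a word = Word (letters: "'a list")

instantiation word :: (type) monoid_add
begin

definition zero_word :: "'a word" where
  "0 = Word []"

definition plus_word :: "'a word \<Rightarrow> 'a word \<Rightarrow> 'a word" where
  "u + v = Word (letters u @ letters v)"

instance
  by standard (simp_all add: zero_word_def plus_word_def)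

end

type_synonym ('k, 'n) free_algebra = "'n symbol word \<Rightarrow>\<^sub>0 'k"

definition free_x :: "'n \<Rightarrow> ('k::field, 'n) free_algebra" where
  "free_x i = Poly_Mapping.single (Word [Sym i]) 1"

definition free_xstar :: "'n \<Rightarrow> ('k::field, 'n) free_algebra" where
  "free_xstar i = Poly_Mapping.single (Word [SymStar i]) 1"

definition free_const :: "'k::field \<Rightarrow> ('k, 'n) free_algebra" where
  "free_const c = Poly_Mapping.single 0 c"

inductive_set two_sided_ideal :: "'a::ring_1 set \<Rightarrow> 'a set" for S where
  zero: "0 \<in> two_sided_ideal S"
| gen: "r \<in> S \<Longrightarrow> a * r * b \<in> two_sided_ideal S"
| add: "p \<in> two_sided_ideal S \<Longrightarrow> q \<in> two_sided_ideal S \<Longrightarrow> p + q \<in> two_sided_ideal S"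

lemma two_sided_ideal_mult_left:
  "p \<in> two_sided_ideal S \<Longrightarrow> c * p \<in> two_sided_ideal S"
proof (induction rule: two_sided_ideal.induct)
  case (gen r a b)
  then show ?case
    using two_sided_ideal.gen[of r S "c * a" b] by (simp add: mult.assoc)
qed (auto simp: distrib_left intro: two_sided_ideal.intros)

lemma two_sided_ideal_mult_right:
  "p \<in> two_sided_ideal S \<Longrightarrow> p * c \<in> two_sided_ideal S"
proof (induction rule: two_sided_ideal.induct)
  case (gen r a b)
  then show ?case
    using two_sided_ideal.gen[of r S a "b * c"] by (simp add: mult.assoc)
qed (auto simp: distrib_right intro: two_sided_ideal.intros)

lemma two_sided_ideal_uminus:
  "p \<in> two_sided_ideal S \<Longrightarrow> - p \<in> two_sided_ideal S"
  using two_sided_ideal_mult_left[of p S "- 1"] by simp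

lemma two_sided_ideal_diff:
  "p \<in> two_sided_ideal S \<Longrightarrow> q \<in> two_sided_ideal S \<Longrightarrow> p - q \<in> two_sided_ideal S"
  using two_sided_ideal.add[of p S "- q"] two_sided_ideal_uminus[of q S] by simp

definition leavitt_relations :: "('k::field, 'n::finite) free_algebra set" where
  "leavitt_relations =
     insert ((\<Sum>i\<in>UNIV. free_x i * free_xstar i) - 1)
       {free_xstar i * free_x j - (if i = j then 1 else 0) | i j. True}"

definition leavitt_rel ::
  "('k::field, 'n::finite) free_algebra \<Rightarrow> ('k, 'n) free_algebra \<Rightarrow> bool" where
  "leavitt_rel p q \<longleftrightarrow> p - q \<in> two_sided_ideal leavitt_relations"

lemma equivp_leavitt_rel: "equivp leavitt_rel"
proof (rule equivpI)
  show "reflp leavitt_rel"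
    by (auto simp: reflp_def leavitt_rel_def intro: two_sided_ideal.zero)
  show "symp leavitt_rel"
    unfolding symp_def leavitt_rel_def using two_sided_ideal_uminus by fastforce
  show "transp leavitt_rel"
    unfolding transp_def leavitt_rel_def using two_sided_ideal.add by fastforce
qed

text \<open>\<open>('k, 'n) leavitt\<close> is $L_K(1,n)$ for the field \<open>'k\<close> and \<open>n = CARD('n)\<close>.\<close>

quotient_type (overloaded) ('k, 'n) leavitt =
  "('k::field, 'n::finite) free_algebra" / leavitt_rel
  by (rule equivp_leavitt_rel)

text \<open>
  A representation of the Leavitt algebra on functions of infinite sequences.  It only serves to
  show that \<open>1 \<noteq> 0\<close> holds in the quotient, as the class \<^class>\<open>ring_1\<close> requires.
\<close>

fun symbol_act :: "'n symbol \<Rightarrow> ((nat \<Rightarrow> 'n) \<Rightarrow> 'k::field) \<Rightarrow> (nat \<Rightarrow> 'n) \<Rightarrow> 'k" where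
  "symbol_act (Sym i) f w = (if w 0 = i then f (\<lambda>j. w (Suc j)) else 0)"
| "symbol_act (SymStar i) f w = f (case_nat i w)"

definition word_act :: "'n symbol word \<Rightarrow> ((nat \<Rightarrow> 'n) \<Rightarrow> 'k::field) \<Rightarrow> (nat \<Rightarrow> 'n) \<Rightarrow> 'k" where
  "word_act u f = foldr symbol_act (letters u) f"

definition free_act ::
  "('k::field, 'n) free_algebra \<Rightarrow> ((nat \<Rightarrow> 'n) \<Rightarrow> 'k) \<Rightarrow> (nat \<Rightarrow> 'n) \<Rightarrow> 'k" where
  "free_act p f w = (\<Sum>u\<in>Poly_Mapping.keys p. Poly_Mapping.lookup p u * word_act u f w)"

lemma symbol_act_add: "symbol_act a (\<lambda>w. f w + g w) = (\<lambda>w. symbol_act a f w + symbol_act a g w)"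
  by (cases a) auto

lemma symbol_act_scale: "symbol_act a (\<lambda>w. c * f w) = (\<lambda>w. c * symbol_act a f w)"
  by (cases a) auto

lemma word_act_add: "word_act u (\<lambda>w. f w + g w) = (\<lambda>w. word_act u f w + word_act u g w)"
proof -
  have "foldr symbol_act xs (\<lambda>w. f w + g w) =
      (\<lambda>w. foldr symbol_act xs f w + foldr symbol_act xs g w)" for xs
    by (induction xs) (simp_all add: symbol_act_add)
  then show ?thesis
    by (simp add: word_act_def)
qed

lemma word_act_scale: "word_act u (\<lambda>w. c * f w) = (\<lambda>w. c * word_act u f w)"
proof -
  have "foldr symbol_act xs (\<lambda>w. c * f w) = (\<lambda>w. c * foldr symbol_act xs f w)" for xs
    by (induction xs) (simp_all add: symbol_act_scale)
  then show ?thesis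
    by (simp add: word_act_def)
qed

lemma word_act_plus: "word_act (u + v) f = word_act u (word_act v f)"
  by (simp add: word_act_def plus_word_def)

lemma word_act_zero_fun: "word_act u (\<lambda>w. 0) = (\<lambda>w. 0)"
  using word_act_scale[of u 0 "\<lambda>w. 0"] by simp

lemma free_act_superset:
  assumes "finite A" "Poly_Mapping.keys p \<subseteq> A"
  shows "free_act p f w = (\<Sum>u\<in>A. Poly_Mapping.lookup p u * word_act u f w)"
  unfolding free_act_def using assms
  by (intro sum.mono_neutral_left) (auto simp: in_keys_iff)

lemma free_act_zero: "free_act 0 f = (\<lambda>w. 0)"
  by (simp add: free_act_def fun_eq_iff)

lemma free_act_add: "free_act (p + q) f = (\<lambda>w. free_act p f w + free_act q f w)"
proof
  fix w
  let ?A = "Poly_Mapping.keys p \<union> Poly_Mapping.keys q"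
  have "free_act (p + q) f w = (\<Sum>u\<in>?A. Poly_Mapping.lookup (p + q) u * word_act u f w)"
    by (rule free_act_superset) (auto simp: Poly_Mapping.keys_add)
  also have "\<dots> = (\<Sum>u\<in>?A. Poly_Mapping.lookup p u * word_act u f w) +
      (\<Sum>u\<in>?A. Poly_Mapping.lookup q u * word_act u f w)"
    by (simp add: lookup_add distrib_right sum.distrib)
  also have "\<dots> = free_act p f w + free_act q f w"
    by (simp add: free_act_superset[of ?A p] free_act_superset[of ?A q])
  finally show "free_act (p + q) f w = free_act p f w + free_act q f w" .
qed

lemma free_act_single: "free_act (Poly_Mapping.single u c) f = (\<lambda>w. c * word_act u f w)"
  by (cases "c = 0") (simp_all add: free_act_def fun_eq_iff)

lemma free_act_one: "free_act 1 f = f"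
  unfolding single_one[symmetric] free_act_single by (simp add: word_act_def zero_word_def)

lemma free_act_uminus: "free_act (- p) f = (\<lambda>w. - free_act p f w)"
proof
  fix w
  have "free_act (p + - p) f w = 0"
    by (simp add: free_act_zero)
  then show "free_act (- p) f w = - free_act p f w"
    by (simp only: free_act_add) (simp add: eq_neg_iff_add_eq_0 add.commute)
qed

lemma free_act_diff: "free_act (p - q) f = (\<lambda>w. free_act p f w - free_act q f w)"
  using free_act_add[of p "- q" f] by (simp add: free_act_uminus)

lemma free_act_sum: "free_act (\<Sum>i\<in>A. h i) f = (\<lambda>w. \<Sum>i\<in>A. free_act (h i) f w)"
  by (induction A rule: infinite_finite_induct) (simp_all add: free_act_zero free_act_add)

lemma free_act_add_fun: "free_act p (\<lambda>w. f w + g w) = (\<lambda>w. free_act p f w + free_act p g w)"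
  by (simp add: free_act_def word_act_add distrib_left sum.distrib fun_eq_iff)

lemma poly_mapping_single_induct [case_names single add]:
  assumes single: "\<And>u c. P (Poly_Mapping.single u c)"
    and add: "\<And>p q. P p \<Longrightarrow> P q \<Longrightarrow> P (p + q)"
  shows "P (p :: 'a \<Rightarrow>\<^sub>0 'b::comm_monoid_add)"
proof (induction p rule: update_induct)
  case const
  show ?case
    using single[of undefined 0] by simp
next
  case (update p a b)
  have "Poly_Mapping.update a b p = p + Poly_Mapping.single a b"
    using update.hyps
    by (intro poly_mapping_eqI) (auto simp: lookup_update lookup_add lookup_single in_keys_iff when_def)
  then show ?case
    using add[OF update.IH single] by simp
qed

lemma free_act_mult: "free_act (p * q) f = free_act p (free_act q f)"
proof (induction p rule: poly_mapping_single_induct)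
  case (single u c)
  show ?case
  proof (induction q rule: poly_mapping_single_induct)
    case (single v d)
    show ?case
      by (simp add: mult_single free_act_single word_act_plus word_act_scale mult.assoc)
  next
    case (add p q)
    then show ?case
      by (simp add: distrib_left free_act_add free_act_add_fun)
  qed
next
  case (add p q)
  then show ?case
    by (simp add: distrib_right free_act_add)
qed

lemma free_act_relation:
  assumes "r \<in> leavitt_relations"
  shows "free_act r f = (\<lambda>w. 0)"
proof -
  have x: "free_act (free_x i) g w = (if w 0 = i then g (\<lambda>j. w (Suc j)) else 0)" for i g and w :: "nat \<Rightarrow> 'a"
    by (simp add: free_x_def free_act_single word_act_def)
  have y: "free_act (free_xstar i) g w = g (case_nat i w)" for i g and w :: "nat \<Rightarrow> 'a"
    by (simp add: free_xstar_def free_act_single word_act_def)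
  have [simp]: "case_nat (w 0) (\<lambda>j. w (Suc j)) = w" for w :: "nat \<Rightarrow> 'a"
    by (auto simp: fun_eq_iff split: nat.split)
  show ?thesis
    using assms unfolding leavitt_relations_def
    by (auto simp: fun_eq_iff free_act_diff free_act_sum free_act_mult x y free_act_one free_act_zero)
qed

lemma free_act_ideal:
  "p \<in> two_sided_ideal leavitt_relations \<Longrightarrow> free_act p f = (\<lambda>w. 0)"
proof (induction arbitrary: f rule: two_sided_ideal.induct)
  case (gen r a b)
  have "free_act a (\<lambda>w. 0) = (\<lambda>w. 0)"
    by (rule ext) (simp add: free_act_def word_act_zero_fun)
  then show ?case
    by (simp add: free_act_mult free_act_relation[OF gen])
qed (simp_all add: free_act_zero free_act_add)

lemma one_notin_leavitt_ideal:
  "(1 :: ('k::field, 'n::finite) free_algebra) \<notin> two_sided_ideal leavitt_relations"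
proof
  assume "(1 :: ('k, 'n) free_algebra) \<in> two_sided_ideal leavitt_relations"
  from free_act_ideal[OF this, of "\<lambda>w. 1"] show False
    by (simp add: free_act_one fun_eq_iff)
qed

instantiation leavitt :: (field, finite) ring_1
begin

lift_definition zero_leavitt :: "('a, 'b) leavitt" is 0 .

lift_definition one_leavitt :: "('a, 'b) leavitt" is 1 .

lift_definition plus_leavitt :: "('a, 'b) leavitt \<Rightarrow> ('a, 'b) leavitt \<Rightarrow> ('a, 'b) leavitt" is "(+)"
  unfolding leavitt_rel_def using two_sided_ideal.add by (fastforce simp: algebra_simps)

lift_definition uminus_leavitt :: "('a, 'b) leavitt \<Rightarrow> ('a, 'b) leavitt" is uminus
  unfolding leavitt_rel_def using two_sided_ideal_uminus by fastforce

lift_definition minus_leavitt :: "('a, 'b) leavitt \<Rightarrow> ('a, 'b) leavitt \<Rightarrow> ('a, 'b) leavitt" is "(-)"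
  unfolding leavitt_rel_def using two_sided_ideal_diff by (fastforce simp: algebra_simps)

lift_definition times_leavitt :: "('a, 'b) leavitt \<Rightarrow> ('a, 'b) leavitt \<Rightarrow> ('a, 'b) leavitt" is "(*)"
proof -
  fix p p' q q' :: "('a, 'b) free_algebra"
  assume "leavitt_rel p p'" "leavitt_rel q q'"
  then have "(p - p') * q + p' * (q - q') \<in> two_sided_ideal leavitt_relations"
    unfolding leavitt_rel_def
    by (intro two_sided_ideal.add two_sided_ideal_mult_left two_sided_ideal_mult_right)
  then show "leavitt_rel (p * q) (p' * q')"
    by (simp add: leavitt_rel_def algebra_simps)
qed

instance
proof
  fix a b c :: "('a, 'b) leavitt"
  have eq: "leavitt_rel p q" if "p = q" for p q :: "('a, 'b) free_algebra"
    using that by (simp add: leavitt_rel_def two_sided_ideal.zero)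
  show "a + b + c = a + (b + c)" by transfer (rule eq, simp add: add.assoc)
  show "a + b = b + a" by transfer (rule eq, simp add: add.commute)
  show "0 + a = a" by transfer (rule eq, simp)
  show "- a + a = 0" by transfer (rule eq, simp)
  show "a - b = a + - b" by transfer (rule eq, simp)
  show "a * b * c = a * (b * c)" by transfer (rule eq, simp add: mult.assoc)
  show "(a + b) * c = a * c + b * c" by transfer (rule eq, simp add: distrib_right)
  show "a * (b + c) = a * b + a * c" by transfer (rule eq, simp add: distrib_left)
  show "1 * a = a" by transfer (rule eq, simp)
  show "a * 1 = a" by transfer (rule eq, simp)
  show "(0 :: ('a, 'b) leavitt) \<noteq> 1"
  proof transfer
    show "\<not> leavitt_rel 0 (1 :: ('a, 'b) free_algebra)"
      using two_sided_ideal_uminus[of "- 1 :: ('a, 'b) free_algebra"] one_notin_leavitt_ideal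
      by (auto simp: leavitt_rel_def)
  qed
qed

end

lift_definition leavitt_scale :: "'k::field \<Rightarrow> ('k, 'n::finite) leavitt \<Rightarrow> ('k, 'n) leavitt"
  is "\<lambda>c p. free_const c * p"
  unfolding leavitt_rel_def using two_sided_ideal_mult_left by (fastforce simp: algebra_simps)

text \<open>
  The matrix ring \<open>\<M>\<^sub>s(L\<^sub>K(1,n))\<close> is \<^const>\<open>ring_mat\<close>, with carrier \<open>carrier_mat s s\<close>; \<open>K\<close> acts entrywise.
  \<^const>\<open>ring_hom\<close> includes preservation of the unit, and is stated on the carrier only.
\<close>

definition mat_scale ::
  "'k::field \<Rightarrow> ('k, 'n::finite) leavitt mat \<Rightarrow> ('k, 'n) leavitt mat" where
  "mat_scale c A = map_mat (leavitt_scale c) A"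

definition unital_algebra_hom ::
  "nat \<Rightarrow> nat \<Rightarrow> (('k::field, 'm::finite) leavitt mat \<Rightarrow> ('k, 'n::finite) leavitt mat) \<Rightarrow> bool" where
  "unital_algebra_hom s t f \<longleftrightarrow>
     f \<in> ring_hom (ring_mat TYPE(('k, 'm) leavitt) s ()) (ring_mat TYPE(('k, 'n) leavitt) t ()) \<and>
     (\<forall>c. \<forall>A\<in>carrier_mat s s. f (mat_scale c A) = mat_scale c (f A))"

end

theory Submission
  imports
    Defs
    "HOL-Library.Sublist"
    "Jordan_Normal_Form.Determinant"
begin

text \<open>
  Let \<open>L\<close> be the Leavitt algebra on \<open>n\<close> letters.  The relations say \<open>L \<cong> L\<^sup>n\<close> as right modules, and the
  statement is a consequence of the structure of the finitely generated projective \<open>L\<close>-modules: each of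
  them is free, and free modules of positive ranks are isomorphic exactly if the ranks agree modulo \<open>n - 1\<close>.
  All modules are represented by idempotents of \<open>L\<close>, and the relation \<open>copies I p e u v\<close> expresses an
  isomorphism \<open>eL \<cong> (pL)\<^sup>I\<close>.  A matrix ring over \<open>L\<close> is a corner \<open>eLe\<close>, where \<open>e\<close> is a sum of copies of \<open>1\<close>.

  A unital homomorphism of the matrix rings sends the first diagonal matrix unit to an idempotent \<open>p\<close> with
  \<open>pL \<cong> (pL)\<^sup>m\<close> and \<open>(pL)\<^sup>s \<cong> L\<^sup>t\<close>.  Since \<open>pL \<cong> L\<^sup>k\<close> for some \<open>k\<close> (\<open>ex_copies_of_idempotent\<close>) and ranks are
  unique modulo \<open>n - 1\<close> (\<open>copies_card_cong\<close>), \<open>k\<close> is as required (\<open>matrix_hom_imp_cong\<close>).  Conversely, the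
  congruences give isomorphisms \<open>L\<^sup>k \<cong> L\<^bsup>mk\<^esup>\<close> and \<open>L\<^sup>t \<cong> L\<^bsup>sk\<^esup>\<close> (\<open>ex_copies_both\<close>), hence a homomorphism from the
  Leavitt algebra on \<open>m\<close> letters to a corner and from there to the matrix rings (\<open>cong_imp_matrix_hom\<close>).  It
  is injective because that Leavitt algebra is simple (\<open>leavitt_simple\<close>).

  The two facts on projective modules are proved through the free algebra \<open>R\<close> generated by the \<open>x\<^sub>i\<close>, which
  is embedded in \<open>L\<close>.  Every element of \<open>L\<close> comes to lie in \<open>R\<close> after right multiplication by any
  sufficiently long word.  A right ideal \<open>J\<close> of \<open>R\<close> is free: order the words, and take one element of \<open>J\<close> for
  each leading word that has no proper prefix among the leading words.  This basis remains independent
  over \<open>L\<close>, so for an idempotent \<open>e\<close> the basis of \<open>J = R \<inter> eL\<close> is a finite basis of \<open>eL\<close>.  Any other basis of \<open>eL\<close> can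
  be split along long words into one that lies in \<open>R\<close>.  The right ideal of \<open>R\<close> that it spans has the same
  long leading words as \<open>J\<close>.  The number of leading words of a large length is congruent modulo \<open>n - 1\<close> to the
  number of basis elements, since a leading word of length \<open>l\<close> has \<open>n\<^sup>d\<close> extensions of length \<open>l + d\<close>.
\<close>

section \<open>Generators, scalars and words\<close>

lift_definition gen :: "'n::finite \<Rightarrow> ('k::field, 'n) leavitt" is free_x .

lift_definition gen_star :: "'n::finite \<Rightarrow> ('k::field, 'n) leavitt" is free_xstar .

lemma abs_leavitt_sum: "abs_leavitt (\<Sum>i\<in>A. h i) = (\<Sum>i\<in>A. abs_leavitt (h i))"
  by (induction A rule: infinite_finite_induct)
    (simp_all add: zero_leavitt.abs_eq plus_leavitt.abs_eq[symmetric])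

lemma leavitt_rel_of_relation:
  assumes "p - q \<in> leavitt_relations"
  shows "leavitt_rel p q"
  using two_sided_ideal.gen[OF assms, of 1 1] by (simp add: leavitt_rel_def)

lemma gen_star_gen:
  "gen_star i * gen j = (if i = j then 1 else 0 :: ('a::field, 'b::finite) leavitt)"
proof -
  have "leavitt_rel (free_xstar i * free_x j) (if i = j then 1 else 0 :: ('a::field, 'b) free_algebra)"
    by (rule leavitt_rel_of_relation) (auto simp: leavitt_relations_def)
  then have "abs_leavitt (free_xstar i * free_x j) =
      abs_leavitt (if i = j then 1 else 0 :: ('a::field, 'b) free_algebra)"
    by (simp add: leavitt.abs_eq_iff)
  then show ?thesis
    by (simp add: gen.abs_eq gen_star.abs_eq times_leavitt.abs_eq zero_leavitt.abs_eq
        one_leavitt.abs_eq split: if_splits)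
qed

lemma sum_gen_gen_star: "(\<Sum>i\<in>UNIV. gen i * gen_star i) = (1 :: ('k::field, 'n::finite) leavitt)"
proof -
  have "leavitt_rel (\<Sum>i\<in>UNIV. free_x i * free_xstar i) (1 :: ('k, 'n) free_algebra)"
    by (rule leavitt_rel_of_relation) (auto simp: leavitt_relations_def)
  then have "abs_leavitt (\<Sum>i\<in>UNIV. free_x i * free_xstar i) = abs_leavitt (1 :: ('k, 'n) free_algebra)"
    by (simp add: leavitt.abs_eq_iff)
  then show ?thesis
    by (simp add: abs_leavitt_sum one_leavitt.abs_eq gen.abs_eq gen_star.abs_eq times_leavitt.abs_eq)
qed

lemma leavitt_rel_eqI: "p = q \<Longrightarrow> leavitt_rel p q"
  by (simp add: leavitt_rel_def two_sided_ideal.zero)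

lemma free_const_add: "free_const (a + b) = free_const a + free_const b"
  by (simp add: free_const_def single_add)

lemma free_const_mult: "free_const (a * b) = free_const a * free_const b"
  by (simp add: free_const_def mult_single)

lemma free_const_commute: "p * free_const c = free_const c * p"
proof (induction p rule: poly_mapping_single_induct)
  case (single u d)
  then show ?case by (simp add: free_const_def mult_single mult.commute)
next
  case (add p q)
  then show ?case by (simp add: distrib_left distrib_right)
qed

global_interpretation leavitt: vector_space "leavitt_scale :: 'k::field \<Rightarrow> ('k, 'n::finite) leavitt \<Rightarrow> _"
proof
  fix a b :: 'k and x y :: "('k, 'n) leavitt"
  show "leavitt_scale a (x + y) = leavitt_scale a x + leavitt_scale a y"
    by transfer (rule leavitt_rel_eqI, simp add: distrib_left)
  show "leavitt_scale (a + b) x = leavitt_scale a x + leavitt_scale b x"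
    by transfer (rule leavitt_rel_eqI, simp add: free_const_add distrib_right)
  show "leavitt_scale a (leavitt_scale b x) = leavitt_scale (a * b) x"
    by transfer (rule leavitt_rel_eqI, simp add: free_const_mult mult.assoc)
  show "leavitt_scale 1 x = x"
    by transfer (rule leavitt_rel_eqI, simp add: free_const_def)
qed

lemma scale_mult_left [simp]: "leavitt_scale c a * b = leavitt_scale c (a * b)"
  by transfer (rule leavitt_rel_eqI, simp add: mult.assoc)

lemma scale_mult_right [simp]: "a * leavitt_scale c b = leavitt_scale c (a * b)"
  by transfer (rule leavitt_rel_eqI, metis free_const_commute mult.assoc)

fun gen_sym :: "'n::finite symbol \<Rightarrow> ('k::field, 'n) leavitt" where
  "gen_sym (Sym i) = gen i"
| "gen_sym (SymStar i) = gen_star i"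

lemma abs_leavitt_single:
  "abs_leavitt (Poly_Mapping.single (Word ss) (c :: 'k::field)) =
     leavitt_scale c (foldr (\<lambda>s a. gen_sym s * a) ss 1)"
proof (induction ss)
  case Nil
  then show ?case
    by (simp add: leavitt_scale.abs_eq one_leavitt.abs_eq free_const_def zero_word_def)
next
  case (Cons s ss)
  have "Poly_Mapping.single (Word (s # ss)) c =
      Poly_Mapping.single (Word [s]) 1 * Poly_Mapping.single (Word ss) c"
    by (simp add: mult_single plus_word_def)
  moreover have "abs_leavitt (Poly_Mapping.single (Word [s]) (1 :: 'k)) = gen_sym s"
    by (cases s) (simp_all add: gen.abs_eq gen_star.abs_eq free_x_def free_xstar_def)
  ultimately show ?case
    by (simp only: times_leavitt.abs_eq[symmetric] Cons) simp
qed

lemma leavitt_induct [case_names word add]: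
  assumes "\<And>c ss. P (leavitt_scale c (foldr (\<lambda>s a. gen_sym s * a) ss 1))"
    and "\<And>a b. P a \<Longrightarrow> P b \<Longrightarrow> P (a + b)"
  shows "P (a :: ('k::field, 'n::finite) leavitt)"
proof -
  have "P (abs_leavitt p)" for p
  proof (induction p rule: poly_mapping_single_induct)
    case (single u c)
    then show ?case
      using assms(1)[of c "letters u"] abs_leavitt_single[of "letters u" c] by simp
  next
    case (add p q)
    then show ?case using assms(2) by (simp add: plus_leavitt.abs_eq[symmetric])
  qed
  then show ?thesis by (metis Quotient_abs_rep Quotient_leavitt)
qed

fun gen_word :: "'n list \<Rightarrow> ('k::field, 'n::finite) leavitt" where
  "gen_word [] = 1"
| "gen_word (i # w) = gen i * gen_word w"

fun gen_word_star :: "'n list \<Rightarrow> ('k::field, 'n::finite) leavitt" where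
  "gen_word_star [] = 1"
| "gen_word_star (i # w) = gen_word_star w * gen_star i"

lemma gen_word_append: "gen_word (u @ v) = gen_word u * gen_word v"
  by (induction u) (simp_all add: mult.assoc)

lemma gen_star_gen_mult: "gen_star i * (gen j * a) = (if i = j then a else 0)"
  by (simp add: mult.assoc[symmetric] gen_star_gen)

lemma gen_word_star_append_cancel: "gen_word_star u * gen_word (u @ v) = gen_word v"
  by (induction u) (simp_all add: mult.assoc gen_star_gen_mult)

lemma gen_word_star_gen_word:
  "length u \<le> length v \<Longrightarrow>
     gen_word_star u * gen_word v = (if prefix u v then gen_word (drop (length u) v) else 0)"
proof (induction u arbitrary: v)
  case (Cons i u)
  then show ?case
    by (cases v) (simp_all add: mult.assoc gen_star_gen_mult)
qed simp

lemma gen_word_star_gen_word_eq_length: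
  "length u = length v \<Longrightarrow> gen_word_star u * gen_word v = (if u = v then 1 else 0)"
  by (subst gen_word_star_gen_word) (auto simp: prefix_def)

lemma words_Suc: "{w :: 'n list. length w = Suc N} = (\<lambda>(i, w). i # w) ` (UNIV \<times> {w. length w = N})"
  by (auto simp: length_Suc_conv image_iff)

lemma finite_words: "finite {w :: 'n::finite list. length w = N}"
  using finite_lists_length_eq[of "UNIV :: 'n set" N] by simp

lemma card_words: "card {w :: 'n::finite list. length w = N} = CARD('n) ^ N"
  using card_lists_length_eq[of "UNIV :: 'n set" N] by simp

lemma sum_gen_word_gen_word_star:
  "(\<Sum>w | length w = N. gen_word w * gen_word_star w) = (1 :: ('k::field, 'n::finite) leavitt)"
proof (induction N)
  case (Suc N)
  have "(\<Sum>w | length w = Suc N. gen_word w * gen_word_star w :: ('k, 'n) leavitt) =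
      (\<Sum>(i, w)\<in>UNIV \<times> {w. length w = N}. gen i * (gen_word w * gen_word_star w) * gen_star i)"
    unfolding words_Suc
    by (subst sum.reindex) (auto simp: inj_on_def mult.assoc intro!: sum.cong)
  also have "\<dots> = (\<Sum>i\<in>UNIV. gen i * (\<Sum>w | length w = N. gen_word w * gen_word_star w) * gen_star i)"
    by (simp add: sum.cartesian_product[symmetric] sum_distrib_left sum_distrib_right)
  finally show ?case by (simp add: Suc sum_gen_gen_star)
qed simp

section \<open>Decomposing an idempotent into copies of another\<close>

text \<open>
  In terms of right modules, this says that \<open>eR\<close> is a direct sum of copies of \<open>pR\<close> indexed by \<open>I\<close>:
  the maps \<open>pR \<rightarrow> eR\<close> and \<open>eR \<rightarrow> pR\<close> of the \<open>i\<close>-th summand are left multiplication by \<open>u i\<close> and by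
  \<open>v i\<close>.  For \<open>p = 1\<close> it says that \<open>eR\<close> is free with basis \<open>u\<close> and coordinate functions \<open>v\<close>.
\<close>

definition copies :: "'i set \<Rightarrow> 'a::ring_1 \<Rightarrow> 'a \<Rightarrow> ('i \<Rightarrow> 'a) \<Rightarrow> ('i \<Rightarrow> 'a) \<Rightarrow> bool" where
  "copies I p e u v \<longleftrightarrow> finite I \<and> (\<Sum>i\<in>I. u i * v i) = e \<and>
     (\<forall>i\<in>I. \<forall>j\<in>I. v i * u j = (if i = j then p else 0)) \<and>
     (\<forall>i\<in>I. u i * p = u i \<and> p * v i = v i)"

lemma copiesI:
  assumes "finite I" "(\<Sum>i\<in>I. u i * v i) = e"
    and "\<And>i j. i \<in> I \<Longrightarrow> j \<in> I \<Longrightarrow> v i * u j = (if i = j then p else 0)"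
    and "\<And>i. i \<in> I \<Longrightarrow> u i * p = u i" "\<And>i. i \<in> I \<Longrightarrow> p * v i = v i"
  shows "copies I p e u v"
  using assms by (simp add: copies_def)

lemma
  assumes "copies I p e u v"
  shows copies_finite: "finite I"
    and copies_sum: "(\<Sum>i\<in>I. u i * v i) = e"
    and copies_orth: "i \<in> I \<Longrightarrow> j \<in> I \<Longrightarrow> v i * u j = (if i = j then p else 0)"
    and copies_right: "i \<in> I \<Longrightarrow> u i * p = u i"
    and copies_left: "i \<in> I \<Longrightarrow> p * v i = v i"
  using assms by (simp_all add: copies_def)

lemma sum_mult_if_eq:
  assumes "finite I" "j \<in> I"
  shows "(\<Sum>i\<in>I. f i * (if i = j then p else 0)) = (f j * p :: 'a::ring_1)"
    and "(\<Sum>i\<in>I. (if j = i then p else 0) * f i) = (p * f j :: 'a::ring_1)"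
proof -
  have "f i * (if i = j then p else 0) = (if i = j then f i * p else 0)"
    "(if j = i then p else 0) * f i = (if j = i then p * f i else 0)" for i by simp_all
  with assms show "(\<Sum>i\<in>I. f i * (if i = j then p else 0)) = f j * p"
    "(\<Sum>i\<in>I. (if j = i then p else 0) * f i) = p * f j" by simp_all
qed

lemma copies_left_mult: "copies I p e u v \<Longrightarrow> i \<in> I \<Longrightarrow> p * (v i * a) = v i * a"
  by (simp add: copies_left mult.assoc[symmetric])

lemma copies_unit_left:
  assumes "copies I p e u v" "j \<in> I"
  shows "e * u j = u j"
proof -
  have "e * u j = (\<Sum>i\<in>I. u i * (v i * u j))"
    by (simp add: copies_sum[OF assms(1), symmetric] sum_distrib_right mult.assoc)
  also have "\<dots> = (\<Sum>i\<in>I. u i * (if i = j then p else 0))"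
    using assms by (intro sum.cong refl) (simp add: copies_orth[OF assms(1)])
  finally show ?thesis
    using assms by (simp add: sum_mult_if_eq copies_finite copies_right)
qed

lemma copies_unit_right:
  assumes "copies I p e u v" "j \<in> I"
  shows "v j * e = v j"
proof -
  have "v j * e = (\<Sum>i\<in>I. (v j * u i) * v i)"
    by (simp add: copies_sum[OF assms(1), symmetric] sum_distrib_left mult.assoc)
  also have "\<dots> = (\<Sum>i\<in>I. (if j = i then p else 0) * v i)"
    using assms by (intro sum.cong refl) (simp add: copies_orth[OF assms(1)])
  finally show ?thesis
    using assms by (simp add: sum_mult_if_eq copies_finite copies_left)
qed

lemma copies_idem:
  assumes "copies I p e u v"
  shows "e * e = e"
proof -
  have "e * e = (\<Sum>i\<in>I. (e * u i) * v i)"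
    by (simp only: copies_sum[OF assms, symmetric] sum_distrib_left mult.assoc)
  also have "\<dots> = (\<Sum>i\<in>I. u i * v i)"
    by (intro sum.cong refl) (simp add: copies_unit_left[OF assms])
  finally show ?thesis by (simp add: copies_sum[OF assms])
qed

lemma copies_compose:
  assumes I: "copies I p e u v" and J: "copies J q p u' v'"
  shows "copies (I \<times> J) q e (\<lambda>(i, j). u i * u' j) (\<lambda>(i, j). v' j * v i)"
proof (rule copiesI)
  show "finite (I \<times> J)"
    using I J by (simp add: copies_finite)
  have "(\<Sum>(i, j)\<in>I \<times> J. u i * u' j * (v' j * v i)) = (\<Sum>i\<in>I. u i * (\<Sum>j\<in>J. u' j * v' j) * v i)"
    by (simp add: sum.cartesian_product[symmetric] sum_distrib_left sum_distrib_right mult.assoc)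
  also have "\<dots> = e"
    by (simp add: copies_sum[OF J] copies_right[OF I] copies_sum[OF I, symmetric])
  finally show "(\<Sum>x\<in>I \<times> J. (case x of (i, j) \<Rightarrow> u i * u' j) * (case x of (i, j) \<Rightarrow> v' j * v i)) = e"
    by (simp add: case_prod_beta)
next
  fix x y assume "x \<in> I \<times> J" "y \<in> I \<times> J"
  then obtain i j i' j' where [simp]: "x = (i, j)" "y = (i', j')" and
    mem: "i \<in> I" "j \<in> J" "i' \<in> I" "j' \<in> J" by auto
  have "v' j * v i * (u i' * u' j') = v' j * ((v i * u i') * u' j')"
    by (simp add: mult.assoc)
  also have "\<dots> = (if x = y then q else 0)"
    using mem by (simp add: copies_orth[OF I] copies_orth[OF J] copies_unit_left[OF J])
  finally show "(case x of (i, j) \<Rightarrow> v' j * v i) * (case y of (i, j) \<Rightarrow> u i * u' j) =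
      (if x = y then q else 0)" by simp
qed (auto simp: mult.assoc copies_right[OF J] copies_left_mult[OF J])

text \<open>
  A converse of the composition: copies of \<open>q\<close> can be grouped into blocks, each of which is a copy
  of \<open>p\<close>.  The \<open>i\<close>-th map sends \<open>pR\<close> to \<open>(qR)\<^sup>J\<close> by the coordinates \<open>v\<close> and from there into the
  \<open>i\<close>-th block of \<open>eR\<close>.
\<close>

lemma copies_factor:
  assumes IJ: "copies (I \<times> J) q e U V" and J: "copies J q p u v" and I: "finite I"
  shows "copies I p e (\<lambda>i. \<Sum>j\<in>J. U (i, j) * v j) (\<lambda>i. \<Sum>j\<in>J. u j * V (i, j))"
proof (rule copiesI)
  have fin: "finite J" using J by (rule copies_finite)
  have "(\<Sum>j\<in>J. U (i, j) * v j) * (\<Sum>j\<in>J. u j * V (i, j)) = (\<Sum>j\<in>J. U (i, j) * V (i, j))"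
    if "i \<in> I" for i
  proof -
    have "(\<Sum>j\<in>J. U (i, j) * v j) * (\<Sum>j\<in>J. u j * V (i, j)) =
        (\<Sum>j\<in>J. U (i, j) * (\<Sum>j'\<in>J. (v j * u j') * V (i, j')))"
      by (simp only: sum_product) (simp only: sum_distrib_left mult.assoc)
    also have "\<dots> = (\<Sum>j\<in>J. U (i, j) * V (i, j))"
      using that by (intro sum.cong refl)
        (simp add: copies_orth[OF J] sum_mult_if_eq fin copies_left[OF IJ] cong: sum.cong)
    finally show ?thesis .
  qed
  then show "(\<Sum>i\<in>I. (\<Sum>j\<in>J. U (i, j) * v j) * (\<Sum>j\<in>J. u j * V (i, j))) = e"
    by (simp add: copies_sum[OF IJ, symmetric] sum.cartesian_product cong: sum.cong)
  fix i i' assume i: "i \<in> I" "i' \<in> I"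
  have "(\<Sum>j\<in>J. u j * V (i, j)) * (\<Sum>j\<in>J. U (i', j) * v j) =
      (\<Sum>j\<in>J. u j * (\<Sum>j'\<in>J. (V (i, j) * U (i', j')) * v j'))"
    by (simp only: sum_product) (simp only: sum_distrib_left mult.assoc)
  also have "\<dots> = (\<Sum>j\<in>J. u j * (if i = i' then q * v j else 0))"
    using i by (intro sum.cong refl)
      (simp add: copies_orth[OF IJ] sum_mult_if_eq fin cong: sum.cong)
  also have "\<dots> = (if i = i' then p else 0)"
    by (simp add: copies_left[OF J] copies_sum[OF J, symmetric])
  finally show "(\<Sum>j\<in>J. u j * V (i, j)) * (\<Sum>j\<in>J. U (i', j) * v j) = (if i = i' then p else 0)" .
next
  fix i
  show "(\<Sum>j\<in>J. U (i, j) * v j) * p = (\<Sum>j\<in>J. U (i, j) * v j)"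
    by (simp add: sum_distrib_right mult.assoc copies_unit_right[OF J])
  show "p * (\<Sum>j\<in>J. u j * V (i, j)) = (\<Sum>j\<in>J. u j * V (i, j))"
    by (simp add: sum_distrib_left mult.assoc[symmetric] copies_unit_left[OF J])
qed (rule I)

lemma copies_reindex:
  assumes "copies I p e u v" "bij_betw h J I"
  shows "copies J p e (u \<circ> h) (v \<circ> h)"
proof (rule copiesI)
  show "finite J" using assms by (simp add: bij_betw_finite copies_finite)
  show "(\<Sum>i\<in>J. (u \<circ> h) i * (v \<circ> h) i) = e"
    using sum.reindex_bij_betw[OF assms(2), of "\<lambda>i. u i * v i"] copies_sum[OF assms(1)] by simp
qed (use assms in \<open>auto simp: copies_def bij_betw_def inj_on_def\<close>)

lemma copies_card:
  assumes "copies I p e u v" "finite J" "card I = card J"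
  obtains u' v' where "copies J p e u' v'"
  using assms copies_reindex finite_same_card_bij[of J I] copies_finite[OF assms(1)] by metis

text \<open>
  In a Leavitt algebra, where \<open>1\<close> is the sum of \<open>CARD('n)\<close> copies of itself, cutting one copy of \<open>1\<close> in this
  way raises the number of copies by \<open>CARD('n) - 1\<close>.
\<close>

lemma copies_replace:
  assumes I: "copies I p e u v" and J: "copies J p p y z" and k: "k \<in> I"
  shows "copies ((I - {k}) <+> J) p e (case_sum u (\<lambda>j. u k * y j)) (case_sum v (\<lambda>j. z j * v k))"
proof (rule copiesI)
  show "finite ((I - {k}) <+> J)" using I J by (simp add: copies_finite)
  have "(\<Sum>i\<in>(I - {k}) <+> J. case_sum u (\<lambda>j. u k * y j) i * case_sum v (\<lambda>j. z j * v k) i) =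
      (\<Sum>i\<in>I - {k}. u i * v i) + u k * (\<Sum>j\<in>J. y j * z j) * v k"
    using I J by (subst sum.Plus)
      (simp_all add: copies_finite sum_distrib_left sum_distrib_right mult.assoc)
  also have "\<dots> = e"
    using k by (simp add: copies_sum[OF J] copies_right[OF I] copies_sum[OF I, symmetric]
        sum.remove[OF copies_finite[OF I] k] add.commute)
  finally show "(\<Sum>i\<in>(I - {k}) <+> J. case_sum u (\<lambda>j. u k * y j) i * case_sum v (\<lambda>j. z j * v k) i) = e" .
  have 1: "z j * v k * u i = z j * (v k * u i)" "v i * (u k * y j) = (v i * u k) * y j"
    "z j * v k * (u k * y j') = z j * ((v k * u k) * y j')" for i j j'
    by (simp_all add: mult.assoc)
  fix a b assume "a \<in> (I - {k}) <+> J" "b \<in> (I - {k}) <+> J"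
  then show "case_sum v (\<lambda>j. z j * v k) a * case_sum u (\<lambda>j. u k * y j) b = (if a = b then p else 0)"
    using k by (auto simp: 1 copies_orth[OF I] copies_orth[OF J] copies_unit_left[OF J] split: if_splits)
qed (auto simp: mult.assoc copies_right[OF I] copies_right[OF J] copies_left[OF I]
    copies_left_mult[OF J])

lemma copies_words:
  assumes "W \<subseteq> {w. length w = N}"
  shows "copies W (1 :: ('k::field, 'n::finite) leavitt) (\<Sum>w\<in>W. gen_word w * gen_word_star w)
    gen_word gen_word_star"
proof (rule copiesI)
  show "finite W" using assms finite_words finite_subset by blast
next
  fix w v assume "w \<in> W" "v \<in> W"
  with assms have "length w = length v" by auto
  then show "gen_word_star w * gen_word v = (if w = v then 1 else 0 :: ('k, 'n) leavitt)"
    by (rule gen_word_star_gen_word_eq_length)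
qed simp_all

lemma copies_gens:
  "copies UNIV (1 :: ('k::field, 'n::finite) leavitt) 1 gen gen_star"
  by (rule copiesI) (simp_all add: sum_gen_gen_star gen_star_gen)

lemma ex_copies_extend:
  assumes "copies {..<r :: nat} (1 :: ('k::field, 'n::finite) leavitt) e u v" "0 < r"
  shows "\<exists>u v. copies {..<r + c * (CARD('n) - 1)} 1 e u v"
proof (induction c)
  case 0
  then show ?case using assms by auto
next
  case (Suc c)
  let ?r = "r + c * (CARD('n) - 1)"
  obtain d where d: "CARD('n) = Suc d" using not0_implies_Suc[of "CARD('n)"] by auto
  obtain u v where uv: "copies {..<?r} (1 :: ('k, 'n) leavitt) e u v" using Suc by auto
  have "0 \<in> {..<?r}" using assms(2) by simp
  note copies_replace[OF uv copies_gens this]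
  moreover have "card (({..<?r} - {0}) <+> (UNIV :: 'n set)) = card {..<r + Suc c * (CARD('n) - 1)}"
    using assms(2) by (simp add: card_Plus d)
  ultimately obtain u' v' where "copies {..<r + Suc c * (CARD('n) - 1)} (1 :: ('k, 'n) leavitt) e u' v'"
    by (rule copies_card[OF _ finite_lessThan])
  then show ?case by blast
qed

lemma ex_copies:
  assumes "1 < CARD('n::finite)"
  shows "\<exists>e u v. copies {..<r :: nat} (1 :: ('k::field, 'n) leavitt) e u v"
proof -
  have "r < CARD('n) ^ r" using assms by (simp add: power_gt_expt)
  then have "r \<le> card {w :: 'n list. length w = r}" by (simp add: card_words)
  then obtain W where "W \<subseteq> {w :: 'n list. length w = r}" "card W = r" "finite W"
    using obtain_subset_with_card_n by blast
  then have "copies W (1 :: ('k, 'n) leavitt) (\<Sum>w\<in>W. gen_word w * gen_word_star w) gen_word gen_word_star"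
    and "card W = card {..<r}" by (simp_all add: copies_words)
  then obtain u v where "copies {..<r} (1 :: ('k, 'n) leavitt) (\<Sum>w\<in>W. gen_word w * gen_word_star w) u v"
    by (rule copies_card[OF _ finite_lessThan])
  then show ?thesis by blast
qed

text \<open>
  One starts with the smaller number of copies and reaches the larger one by cutting copies of \<open>1\<close>.
  Both numbers must be positive, since zero copies leave nothing to cut.
\<close>

lemma ex_copies_both:
  assumes n: "1 < CARD('n::finite)" and "[a = b] (mod (CARD('n) - 1))" "0 < a" "0 < b"
  shows "\<exists>e u v u' v'. copies {..<a :: nat} (1 :: ('k::field, 'n) leavitt) e u v \<and> copies {..<b :: nat} 1 e u' v'"
proof -
  have *: "\<exists>e u v u' v'. copies {..<a :: nat} (1 :: ('k::field, 'n) leavitt) e u v \<and> copies {..<b :: nat} 1 e u' v'"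
    if ab: "[a = b] (mod (CARD('n) - 1))" "0 < a" "a \<le> b" for a b :: nat
  proof -
    obtain c where "b = a + c * (CARD('n) - 1)"
      using cong_le_nat[OF ab(3)] ab(1) by (auto simp: cong_sym_eq add.commute)
    moreover obtain e u v where "copies {..<a} (1 :: ('k, 'n) leavitt) e u v"
      using ex_copies[OF n] by blast
    ultimately show ?thesis using ex_copies_extend[OF _ ab(2)] by blast
  qed
  show ?thesis
  proof (cases "a \<le> b")
    case True
    then show ?thesis using * assms by blast
  next
    case False
    then show ?thesis using *[of b a] assms by (fastforce simp: cong_sym_eq)
  qed
qed

section \<open>The free algebra inside the Leavitt algebra\<close>

text \<open>
  The action on functions of infinite sequences that shows \<open>1 \<noteq> 0\<close> also reads off coefficients:
  \<open>gen_word u\<close> maps the indicator function of the sequence \<open>\<xi>\<close> to that of \<open>conc u \<xi>\<close>.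
\<close>

lift_definition leavitt_act ::
  "('k::field, 'n::finite) leavitt \<Rightarrow> ((nat \<Rightarrow> 'n) \<Rightarrow> 'k) \<Rightarrow> (nat \<Rightarrow> 'n) \<Rightarrow> 'k" is free_act
proof -
  fix p q :: "('k, 'n) free_algebra"
  assume "leavitt_rel p q"
  then have "free_act (p - q) f = (\<lambda>w. 0)" for f
    unfolding leavitt_rel_def by (rule free_act_ideal)
  then show "free_act p = free_act q"
    by (simp add: free_act_diff fun_eq_iff)
qed

lemma leavitt_act_add: "leavitt_act (a + b) f \<xi> = leavitt_act a f \<xi> + leavitt_act b f \<xi>"
  by transfer (simp add: free_act_add)

lemma leavitt_act_mult: "leavitt_act (a * b) f = leavitt_act a (leavitt_act b f)"
  by transfer (simp add: free_act_mult)

lemma leavitt_act_scale: "leavitt_act (leavitt_scale c a) f \<xi> = c * leavitt_act a f \<xi>"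
  by transfer (simp add: free_act_mult free_const_def free_act_single word_act_def zero_word_def)

lemma leavitt_act_one: "leavitt_act 1 f = f"
  by transfer (simp add: free_act_one)

lemma leavitt_act_gen:
  "leavitt_act (gen i) f \<xi> = (if \<xi> 0 = i then f (\<lambda>j. \<xi> (Suc j)) else 0)"
  by transfer (simp add: free_x_def free_act_single word_act_def)

fun conc :: "'n list \<Rightarrow> (nat \<Rightarrow> 'n) \<Rightarrow> nat \<Rightarrow> 'n" where
  "conc [] \<xi> = \<xi>"
| "conc (i # w) \<xi> = case_nat i (conc w \<xi>)"

lemma leavitt_act_gen_word:
  "leavitt_act (gen_word u) (\<lambda>\<eta>. if \<eta> = \<xi> then 1 else 0) =
     (\<lambda>\<eta>. if \<eta> = conc u \<xi> then 1 else (0 :: 'k::field))"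
proof (induction u)
  case (Cons i u)
  have "(\<eta> 0 = i \<and> (\<lambda>j. \<eta> (Suc j)) = conc u \<xi>) \<longleftrightarrow> \<eta> = case_nat i (conc u \<xi>)" for \<eta> :: "nat \<Rightarrow> 'a"
    by (auto simp: fun_eq_iff split: nat.split)
  from this[symmetric] show ?case
    by (intro ext) (simp add: leavitt_act_mult leavitt_act_gen Cons)
qed (simp add: leavitt_act_one)

text \<open>
  If the sequences \<open>conc u \<xi>\<close> are distinct for distinct words \<open>u\<close>, the images of the indicator
  function of \<open>\<xi>\<close> under the monomials \<open>gen_word u\<close> have disjoint supports, which makes the monomials
  linearly independent and gives coefficient functionals that are defined on the whole algebra.
\<close>

locale aperiodic_sequence =
  fixes \<xi> :: "nat \<Rightarrow> 'n::finite"
  assumes aperiodic: "conc u \<xi> = conc v \<xi> \<Longrightarrow> u = v"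

lemma conc_nth: "conc w \<xi> j = (if j < length w then w ! j else \<xi> (j - length w))"
proof (induction w arbitrary: j)
  case (Cons i w)
  then show ?case by (cases j) auto
qed simp

text \<open>
  The sequence \<open>a, b, b, b, \<dots>\<close> with \<open>a \<noteq> b\<close> works: in \<open>conc u \<xi>\<close> the position \<open>length u\<close> is the last one
  that carries the letter \<open>a\<close>.
\<close>

lemma ex_aperiodic_sequence:
  assumes "1 < CARD('n::finite)"
  shows "\<exists>\<xi> :: nat \<Rightarrow> 'n. aperiodic_sequence \<xi>"
proof -
  obtain a b :: 'n where ab: "a \<noteq> b"
    using assms card_le_Suc0_iff_eq[of "UNIV :: 'n set"] by auto
  let ?\<xi> = "\<lambda>j :: nat. if j = 0 then a else b"
  have le: "length v \<le> length u" if eq: "conc u ?\<xi> = conc v ?\<xi>" for u v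
  proof (rule ccontr)
    assume "\<not> length v \<le> length u"
    then show False
      using fun_cong[OF eq, of "length v"] ab by (simp add: conc_nth)
  qed
  have "u = v" if eq: "conc u ?\<xi> = conc v ?\<xi>" for u v
  proof (rule nth_equalityI)
    show len: "length u = length v"
      using le[OF eq] le[OF eq[symmetric]] by simp
    show "u ! j = v ! j" if "j < length u" for j
      using fun_cong[OF eq, of j] that len by (simp add: conc_nth)
  qed
  then show ?thesis
    by (intro exI[of _ ?\<xi>]) (auto simp: aperiodic_sequence_def)
qed

text \<open>
  The copy of the free algebra on the \<open>gen i\<close> inside the Leavitt algebra.
\<close>

definition polys :: "('k::field, 'n::finite) leavitt set" where
  "polys = leavitt.span (range gen_word)"

lemma polys_subspace: "leavitt.subspace polys"
  by (simp add: polys_def)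

lemmas polys_add = leavitt.subspace_add[OF polys_subspace]
  and polys_scale = leavitt.subspace_scale[OF polys_subspace]
  and polys_zero = leavitt.subspace_0[OF polys_subspace]
  and polys_sum = leavitt.subspace_sum[OF polys_subspace]

lemma polys_gen_word: "gen_word w \<in> polys"
  by (simp add: polys_def leavitt.span_base)

lemma polys_one: "1 \<in> polys"
  using polys_gen_word[of "[]"] by simp

lemma polys_induct [consumes 1, case_names word add scale zero]:
  assumes "a \<in> polys" "\<And>w. P (gen_word w)" "\<And>a b. P a \<Longrightarrow> P b \<Longrightarrow> P (a + b)"
    "\<And>c a. P a \<Longrightarrow> P (leavitt_scale c a)" "P 0"
  shows "P a"
proof -
  have "leavitt.subspace {a. P a}"
    using assms(3-5) by (simp add: leavitt.subspace_def)
  then have "a \<in> {a. P a}"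
    using assms(1,2) leavitt.span_induct[of a "range gen_word" "\<lambda>a. P a"] by (auto simp: polys_def)
  then show ?thesis by simp
qed

lemma polys_mult:
  assumes "a \<in> polys" "b \<in> polys"
  shows "a * b \<in> polys"
  using assms(1)
proof (induction rule: polys_induct)
  case (word w)
  from assms(2) show ?case
    by (induction rule: polys_induct)
      (auto simp: gen_word_append[symmetric] distrib_left
        intro: polys_gen_word polys_add polys_scale polys_zero)
qed (auto simp: distrib_right intro: polys_add polys_scale polys_zero)

text \<open>
  Right multiplication by a long word cancels every \<open>gen_star\<close>: each starred letter of a word
  consumes at most one letter of the factor to its right.
\<close>

lemma ex_mult_gen_word_poly:
  "\<exists>N. \<forall>w. N \<le> length w \<longrightarrow> a * gen_word w \<in> (polys :: ('k::field, 'n::finite) leavitt set)"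
proof (induction a rule: leavitt_induct)
  case (word c ss)
  have "foldr (\<lambda>s a. gen_sym s * a) ss 1 * gen_word w = (0 :: ('k, 'n) leavitt) \<or>
     (\<exists>v. length w \<le> length v + length ss \<and>
        foldr (\<lambda>s a. gen_sym s * a) ss 1 * gen_word w = (gen_word v :: ('k, 'n) leavitt))"
    if "length ss \<le> length w" for w
    using that
  proof (induction ss)
    case Nil
    then show ?case by auto
  next
    case (Cons s ss)
    let ?p = "foldr (\<lambda>s a. gen_sym s * a) ss 1 * gen_word w :: ('k, 'n) leavitt"
    consider "?p = 0" | v where "length w \<le> length v + length ss" "?p = gen_word v"
      using Cons by force
    then show ?case
    proof cases
      case 1
      then show ?thesis by (simp add: mult.assoc)
    next
      case (2 v)
      show ?thesis
      proof (cases s)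
        case (Sym i)
        with 2 show ?thesis
          by (intro disjI2 exI[of _ "i # v"]) (simp add: mult.assoc)
      next
        case (SymStar i)
        obtain j v' where v: "v = j # v'"
          using 2 Cons.prems by (cases v) auto
        show ?thesis
        proof (cases "i = j")
          case True
          with 2 v SymStar show ?thesis
            by (intro disjI2 exI[of _ v']) (simp add: mult.assoc gen_star_gen_mult)
        next
          case False
          with 2 v SymStar show ?thesis
            by (intro disjI1) (simp add: mult.assoc gen_star_gen_mult)
        qed
      qed
    qed
  qed
  then have "leavitt_scale c (foldr (\<lambda>s a. gen_sym s * a) ss 1) * gen_word w \<in> (polys :: ('k, 'n) leavitt set)"
    if "length ss \<le> length w" for w
    using that polys_scale[OF polys_gen_word] polys_zero by fastforce
  then show ?case by blast
next
  case (add a b)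
  then obtain M N where "\<forall>w. M \<le> length w \<longrightarrow> a * gen_word w \<in> polys"
    "\<forall>w. N \<le> length w \<longrightarrow> b * gen_word w \<in> polys" by blast
  then show ?case
    by (intro exI[of _ "max M N"]) (auto simp: distrib_right intro!: polys_add)
qed

lemma ex_uniform_mult_gen_word_poly:
  assumes "finite S"
  shows "\<exists>N. \<forall>a\<in>S. \<forall>w. N \<le> length w \<longrightarrow> a * gen_word w \<in> polys"
  using assms
proof (induction S)
  case (insert a S)
  then obtain N where "\<forall>a\<in>S. \<forall>w. N \<le> length w \<longrightarrow> a * gen_word w \<in> polys" by blast
  moreover obtain M where "\<forall>w. M \<le> length w \<longrightarrow> a * gen_word w \<in> polys"
    using ex_mult_gen_word_poly by blast
  ultimately show ?case
    by (intro exI[of _ "max M N"]) auto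
qed simp

text \<open>
  Together with \<open>ex_mult_gen_word_poly\<close>, this expresses every element through polynomials and the elements
  \<open>gen_word_star w\<close> with \<open>w\<close> of one fixed length.
\<close>

lemma expand_by_words:
  "a = (\<Sum>w | length w = N. a * gen_word w * gen_word_star w)" for a :: "('k::field, 'n::finite) leavitt"
proof -
  have "a = a * (\<Sum>w | length w = N. gen_word w * gen_word_star w)"
    by (simp add: sum_gen_word_gen_word_star)
  then show ?thesis by (simp add: sum_distrib_left mult.assoc)
qed

context aperiodic_sequence
begin

definition coeff_at :: "('k::field, 'n) leavitt \<Rightarrow> 'n list \<Rightarrow> 'k" where
  "coeff_at a u = leavitt_act a (\<lambda>\<eta>. if \<eta> = \<xi> then 1 else 0) (conc u \<xi>)"

lemma coeff_at_add: "coeff_at (a + b) u = coeff_at a u + coeff_at b u"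
  by (simp add: coeff_at_def leavitt_act_add)

lemma coeff_at_scale: "coeff_at (leavitt_scale c a) u = c * coeff_at a u"
  by (simp add: coeff_at_def leavitt_act_scale)

lemma coeff_at_zero: "coeff_at 0 u = 0"
  using coeff_at_scale[of 0 0 u] by simp

lemma coeff_at_diff: "coeff_at (a - b) u = coeff_at a u - coeff_at b u"
  using coeff_at_add[of "a - b" b u] by simp

lemma coeff_at_sum: "coeff_at (\<Sum>i\<in>A. h i) u = (\<Sum>i\<in>A. coeff_at (h i) u)"
  by (induction A rule: infinite_finite_induct) (simp_all add: coeff_at_zero coeff_at_add)

lemma coeff_at_gen_word: "coeff_at (gen_word u) v = (if u = v then 1 else 0)"
  using aperiodic[of u v] aperiodic[of v u] by (auto simp: coeff_at_def leavitt_act_gen_word)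

text \<open>
  Allowing any finite superset of \<open>S\<close> makes it possible to expand several polynomials over a common
  set of words, which is also what the induction step for sums requires.
\<close>

lemma poly_expansion:
  assumes "a \<in> polys"
  obtains S where "finite S"
    "\<And>T. finite T \<Longrightarrow> S \<subseteq> T \<Longrightarrow> a = (\<Sum>u\<in>T. leavitt_scale (coeff_at a u) (gen_word u))"
proof -
  have "\<exists>S. finite S \<and>
      (\<forall>T. finite T \<longrightarrow> S \<subseteq> T \<longrightarrow> a = (\<Sum>u\<in>T. leavitt_scale (coeff_at a u) (gen_word u)))"
    using assms
  proof (induction rule: polys_induct)
    case (word w)
    have *: "gen_word w = (\<Sum>u\<in>T. leavitt_scale (coeff_at (gen_word w) u) (gen_word u))"
      if "finite T" "{w} \<subseteq> T" for T
    proof -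
      have "leavitt_scale (coeff_at (gen_word w) u) (gen_word u) = (if w = u then gen_word u else 0)" for u
        by (simp add: coeff_at_gen_word)
      then have "(\<Sum>u\<in>T. leavitt_scale (coeff_at (gen_word w) u) (gen_word u)) =
          (\<Sum>u\<in>T. if w = u then gen_word u else 0)" by (rule sum.cong[OF refl])
      also have "\<dots> = gen_word w" using that by simp
      finally show ?thesis by (rule sym)
    qed
    show ?case
    proof (intro exI conjI allI impI)
      show "finite {w}" by simp
    qed (rule *)
  next
    case (add a b)
    then obtain S T where "finite S" "finite T"
      "\<forall>U. finite U \<longrightarrow> S \<subseteq> U \<longrightarrow> a = (\<Sum>u\<in>U. leavitt_scale (coeff_at a u) (gen_word u))"
      "\<forall>U. finite U \<longrightarrow> T \<subseteq> U \<longrightarrow> b = (\<Sum>u\<in>U. leavitt_scale (coeff_at b u) (gen_word u))"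
      by blast
    then show ?case
      by (intro exI[of _ "S \<union> T"])
        (simp add: coeff_at_add leavitt.scale_left_distrib sum.distrib)
  next
    case (scale c a)
    then obtain S where "finite S"
      "\<forall>U. finite U \<longrightarrow> S \<subseteq> U \<longrightarrow> a = (\<Sum>u\<in>U. leavitt_scale (coeff_at a u) (gen_word u))"
      by blast
    then show ?case
      by (intro exI[of _ S])
        (simp add: coeff_at_scale leavitt.scale_scale[symmetric] leavitt.scale_sum_right[symmetric]
          del: leavitt.scale_scale)
  qed (auto simp: coeff_at_zero)
  then show ?thesis using that by blast
qed

lemma poly_eq_zero:
  assumes "a \<in> polys" "\<And>u. coeff_at a u = 0"
  shows "a = 0"
proof -
  obtain S where "a = (\<Sum>u\<in>S. leavitt_scale (coeff_at a u) (gen_word u))"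
    using poly_expansion[OF assms(1)] by blast
  with assms(2) show ?thesis by simp
qed

lemma finite_poly_support:
  assumes "a \<in> polys"
  shows "finite {u. coeff_at a u \<noteq> 0}"
proof -
  obtain S where S: "finite S" and a: "a = (\<Sum>u\<in>S. leavitt_scale (coeff_at a u) (gen_word u))"
    using poly_expansion[OF assms] by blast
  have "coeff_at a v = 0" if "v \<notin> S" for v
  proof -
    have "coeff_at a v = (\<Sum>u\<in>S. coeff_at (leavitt_scale (coeff_at a u) (gen_word u)) v)"
      using arg_cong[OF a, of "\<lambda>x. coeff_at x v"] by (simp only: coeff_at_sum)
    also have "\<dots> = 0"
      using that by (intro sum.neutral) (auto simp: coeff_at_scale coeff_at_gen_word)
    finally show ?thesis .
  qed
  then have "{u. coeff_at a u \<noteq> 0} \<subseteq> S" by blast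
  with S show ?thesis by (rule finite_subset[rotated])
qed

lemma coeff_at_mult_gen_word:
  assumes "a \<in> polys"
  shows "coeff_at (a * gen_word w) (u @ w) = coeff_at a u"
    and "coeff_at (a * gen_word w) v \<noteq> 0 \<Longrightarrow> \<exists>u. v = u @ w"
proof -
  have "coeff_at (a * gen_word w) (u @ w) = coeff_at a u \<and>
      (\<forall>v. (\<nexists>u. v = u @ w) \<longrightarrow> coeff_at (a * gen_word w) v = 0)"
    using assms
    by (induction rule: polys_induct)
      (auto simp: distrib_right coeff_at_add coeff_at_scale coeff_at_zero coeff_at_gen_word
        gen_word_append[symmetric])
  then show "coeff_at (a * gen_word w) (u @ w) = coeff_at a u"
    "coeff_at (a * gen_word w) v \<noteq> 0 \<Longrightarrow> \<exists>u. v = u @ w" by blast+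
qed

lemma coeff_at_Nil_mult:
  assumes "a \<in> polys" "b \<in> polys"
  shows "coeff_at (a * b) [] = coeff_at a [] * coeff_at b []"
  using assms(1)
proof (induction rule: polys_induct)
  case (word w)
  from assms(2) show ?case
    by (induction rule: polys_induct)
      (auto simp: distrib_left coeff_at_add coeff_at_scale coeff_at_zero coeff_at_gen_word
        gen_word_append[symmetric])
qed (auto simp: distrib_right coeff_at_add coeff_at_scale coeff_at_zero)

end

section \<open>Leading words and bases of right ideals\<close>

text \<open>
  Words are compared by the number that they represent in bijective numeration to the base
  \<open>CARD('n)\<close>; for words this is the order by length and then lexicographically.  The order is
  compatible with right multiplication and, being pulled back from \<open>nat\<close>, it is well-founded.
\<close>

definition letter_index :: "'n::finite \<Rightarrow> nat" where
  "letter_index = (SOME h. inj h \<and> range h \<subseteq> {..<CARD('n)})"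

lemma letter_index: "inj (letter_index :: 'n::finite \<Rightarrow> nat)" "letter_index (i :: 'n) < CARD('n)"
proof -
  obtain h where "bij_betw h (UNIV :: 'n set) {..<CARD('n)}"
    using finite_same_card_bij[of "UNIV :: 'n set" "{..<CARD('n)}"] by auto
  then have "inj h \<and> range h \<subseteq> {..<CARD('n)}" by (simp add: bij_betw_def)
  then have "inj (letter_index :: 'n \<Rightarrow> nat) \<and> range (letter_index :: 'n \<Rightarrow> nat) \<subseteq> {..<CARD('n)}"
    unfolding letter_index_def
    by (rule someI[where P = "\<lambda>h. inj h \<and> range h \<subseteq> {..<CARD('n)}"])
  then show "inj (letter_index :: 'n \<Rightarrow> nat)" "letter_index (i :: 'n) < CARD('n)" by auto
qed

definition word_index :: "'n::finite list \<Rightarrow> nat" where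
  "word_index w = foldl (\<lambda>m i. CARD('n) * m + letter_index i + 1) 0 w"

lemma word_index_snoc:
  "word_index (w @ [i]) = CARD('n) * word_index w + letter_index i + 1" for i :: "'n::finite"
  by (simp add: word_index_def)

lemma word_index_less_append:
  assumes "word_index u < word_index v"
  shows "word_index (u @ w) < word_index (v @ w)"
proof (induction w rule: rev_induct)
  case (snoc i w)
  then show ?case by (simp add: append_assoc[symmetric] word_index_snoc del: append_assoc)
qed (use assms in simp)

lemma word_index_inject: "word_index u = word_index v \<Longrightarrow> u = v" for u v :: "'n::finite list"
proof (induction u arbitrary: v rule: rev_induct)
  case Nil
  then show ?case by (cases v rule: rev_cases) (auto simp: word_index_snoc word_index_def[of "[]"])
next
  case (snoc i u)
  then obtain j v' where v: "v = v' @ [j]"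
    by (cases v rule: rev_cases) (auto simp: word_index_snoc word_index_def[of "[]"])
  have eq: "CARD('n) * word_index u + letter_index i = CARD('n) * word_index v' + letter_index j"
    using snoc.prems by (simp add: v word_index_snoc)
  have "word_index u = word_index v'"
    using arg_cong[OF eq, of "\<lambda>m. m div CARD('n)"] letter_index(2)[of i] letter_index(2)[of j] by simp
  moreover from this eq have "letter_index i = letter_index j" by simp
  ultimately show ?case
    using snoc.IH[of v'] letter_index(1)[where 'n = 'n] by (auto simp: v dest: injD)
qed

context aperiodic_sequence
begin

definition leads :: "('k::field, 'n) leavitt \<Rightarrow> 'n list \<Rightarrow> bool" where
  "leads r w \<longleftrightarrow> coeff_at r w \<noteq> 0 \<and> (\<forall>u. coeff_at r u \<noteq> 0 \<longrightarrow> word_index u \<le> word_index w)"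

lemma ex_leads:
  assumes "r \<in> polys" "r \<noteq> 0"
  shows "\<exists>w. leads r w"
proof -
  let ?S = "{u. coeff_at r u \<noteq> 0}"
  have "finite ?S" "?S \<noteq> {}"
    using finite_poly_support poly_eq_zero assms by auto
  then have "Max (word_index ` ?S) \<in> word_index ` ?S" by (intro Max_in) auto
  then obtain w where w: "Max (word_index ` ?S) = word_index w" "w \<in> ?S" by (rule imageE)
  have "word_index u \<le> word_index w" if "u \<in> ?S" for u
    unfolding w(1)[symmetric] using that \<open>finite ?S\<close> by (intro Max_ge) auto
  with w(2) show ?thesis by (auto simp: leads_def)
qed

lemma leads_unique: "leads r u \<Longrightarrow> leads r v \<Longrightarrow> u = v"
  by (intro word_index_inject antisym) (auto simp: leads_def)

lemma word_index_append_le: "word_index u \<le> word_index v \<Longrightarrow> word_index (u @ w) \<le> word_index (v @ w)"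
  for u v w :: "'n list"
  by (metis word_index_inject word_index_less_append order_le_less)

lemma leads_mult_gen_word:
  assumes "r \<in> polys" "leads r w"
  shows "leads (r * gen_word z) (w @ z)"
  unfolding leads_def
proof (intro conjI allI impI)
  show "coeff_at (r * gen_word z) (w @ z) \<noteq> 0"
    using assms by (simp add: coeff_at_mult_gen_word leads_def)
  fix v assume v: "coeff_at (r * gen_word z) v \<noteq> 0"
  then obtain u where "v = u @ z" using coeff_at_mult_gen_word(2)[OF assms(1)] by blast
  with v assms show "word_index v \<le> word_index (w @ z)"
    by (auto simp: coeff_at_mult_gen_word leads_def intro!: word_index_append_le)
qed

text \<open>
  Among the leading words of the terms with a nonzero coefficient, the largest cannot be cancelled.
\<close>

lemma leads_independent:
  assumes "finite S" "inj_on w S" "\<And>j. j \<in> S \<Longrightarrow> leads (r j) (w j)"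
    and "(\<Sum>j\<in>S. leavitt_scale (c j) (r j)) = 0" "j \<in> S"
  shows "c j = 0"
proof (rule ccontr)
  assume "c j \<noteq> 0"
  let ?T = "{j \<in> S. c j \<noteq> 0}"
  have "finite ?T" "?T \<noteq> {}" using assms(1,5) \<open>c j \<noteq> 0\<close> by auto
  then have "Max ((\<lambda>j. word_index (w j)) ` ?T) \<in> (\<lambda>j. word_index (w j)) ` ?T"
    by (intro Max_in) auto
  then obtain m where m: "Max ((\<lambda>j. word_index (w j)) ` ?T) = word_index (w m)" "m \<in> ?T"
    by (rule imageE)
  have "c j * coeff_at (r j) (w m) = 0" if j: "j \<in> S - {m}" for j
  proof (rule ccontr)
    assume "c j * coeff_at (r j) (w m) \<noteq> 0"
    then have "j \<in> ?T" "coeff_at (r j) (w m) \<noteq> 0" using j by auto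
    then have "word_index (w m) \<le> word_index (w j)"
      using assms(3)[of j] j by (auto simp: leads_def)
    moreover have "word_index (w j) \<le> word_index (w m)"
      unfolding m(1)[symmetric] using \<open>j \<in> ?T\<close> \<open>finite ?T\<close> by (intro Max_ge) auto
    ultimately have "w j = w m" by (intro word_index_inject) simp
    then show False using assms(2) j m(2) by (auto dest: inj_onD)
  qed
  then have "(\<Sum>j\<in>S. c j * coeff_at (r j) (w m)) = c m * coeff_at (r m) (w m)"
    using m(2) assms(1) by (subst sum.remove[of S m]) (auto simp del: mult_eq_0_iff)
  moreover have "(\<Sum>j\<in>S. c j * coeff_at (r j) (w m)) = 0"
    using arg_cong[OF assms(4), of "\<lambda>x. coeff_at x (w m)"]
    by (simp add: coeff_at_sum coeff_at_scale coeff_at_zero)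
  ultimately show False using m(2) assms(3)[of m] by (simp add: leads_def)
qed

definition right_ideal :: "('k::field, 'n) leavitt set \<Rightarrow> bool" where
  "right_ideal J \<longleftrightarrow> J \<subseteq> polys \<and> leavitt.subspace J \<and> (\<forall>r\<in>J. \<forall>d\<in>polys. r * d \<in> J)"

definition leading_words :: "('k::field, 'n) leavitt set \<Rightarrow> 'n list set" where
  "leading_words J = {w. \<exists>r\<in>J. leads r w}"

text \<open>
  The leading words of a right ideal form a set that is closed under appending letters; its elements
  that are minimal for the prefix order are an index set for a basis of the right ideal.
\<close>

definition basis_words :: "('k::field, 'n) leavitt set \<Rightarrow> 'n list set" where
  "basis_words J = {w \<in> leading_words J. \<forall>u\<in>leading_words J. prefix u w \<longrightarrow> u = w}"

definition basis_elt :: "('k::field, 'n) leavitt set \<Rightarrow> 'n list \<Rightarrow> ('k, 'n) leavitt" where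
  "basis_elt J w = (SOME r. r \<in> J \<and> leads r w)"

lemma basis_elt:
  assumes "w \<in> basis_words J"
  shows "basis_elt J w \<in> J" "leads (basis_elt J w) w"
proof -
  have "\<exists>r. r \<in> J \<and> leads r w" using assms by (auto simp: basis_words_def leading_words_def)
  then have "basis_elt J w \<in> J \<and> leads (basis_elt J w) w" unfolding basis_elt_def by (rule someI_ex)
  then show "basis_elt J w \<in> J" "leads (basis_elt J w) w" by auto
qed

lemma basis_elt_poly: "right_ideal J \<Longrightarrow> w \<in> basis_words J \<Longrightarrow> basis_elt J w \<in> polys"
  using basis_elt(1) by (auto simp: right_ideal_def)

lemma basis_words_prefix_free:
  assumes "p \<in> basis_words J" "q \<in> basis_words J" "p @ a = q @ b"
  shows "p = q"
proof -
  have "prefix p q \<or> prefix q p"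
    using assms(3) by (metis prefixI prefix_same_cases)
  with assms(1,2) show ?thesis by (auto simp: basis_words_def)
qed

lemma leading_word_has_basis_prefix:
  assumes "w \<in> leading_words J"
  obtains q z where "q \<in> basis_words J" "w = q @ z"
proof -
  obtain q where q: "q \<in> leading_words J" "prefix q w"
    and min: "\<And>u. u \<in> leading_words J \<Longrightarrow> prefix u w \<Longrightarrow> length q \<le> length u"
    using ex_has_least_nat[of "\<lambda>q. q \<in> leading_words J \<and> prefix q w" w length] assms by auto
  have "u = q" if "u \<in> leading_words J" "prefix u q" for u
    using min[OF that(1) prefix_order.trans[OF that(2) q(2)]] that(2)
    by (metis prefix_length_le prefix_order.antisym le_antisym not_equal_is_parallel parallel_def)
  with q(1) have "q \<in> basis_words J" by (auto simp: basis_words_def)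
  with q(2) that show ?thesis by (auto simp: prefix_def)
qed

lemma leading_words_append:
  assumes "right_ideal J" "w \<in> leading_words J"
  shows "w @ z \<in> leading_words J"
proof -
  obtain r where "r \<in> J" "leads r w" using assms(2) by (auto simp: leading_words_def)
  moreover from this have "r * gen_word z \<in> J" "r \<in> polys"
    using assms(1) polys_gen_word by (auto simp: right_ideal_def)
  ultimately show ?thesis by (auto simp: leading_words_def intro!: leads_mult_gen_word)
qed

text \<open>
  Division with remainder.  The leading word of \<open>r\<close> is \<open>q @ z\<close> for a basis word \<open>q\<close>, so subtracting a
  multiple of \<open>basis_elt J q * gen_word z\<close> gives an element of \<open>J\<close> with a smaller leading word.
\<close>

lemma right_ideal_subset_span:
  assumes J: "right_ideal J" and "r \<in> J"
  shows "r \<in> leavitt.span ((\<lambda>(q, z). basis_elt J q * gen_word z) ` (basis_words J \<times> UNIV))"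
    (is "_ \<in> ?span")
proof -
  have "\<forall>w. leads r w \<longrightarrow> r \<in> ?span" if "r \<in> J" for r
    using that
  proof (induction "LEAST m. \<exists>w. leads r w \<and> word_index w = m" arbitrary: r rule: less_induct)
    case less
    have idx: "(LEAST m. \<exists>w. leads r w \<and> word_index w = m) = word_index w" if "leads r w" for r w
      using that leads_unique by (intro Least_equality) auto
    show ?case
    proof (intro allI impI)
      fix w assume w: "leads r w"
      with less.prems have "w \<in> leading_words J" by (auto simp: leading_words_def)
      then obtain q z where q: "q \<in> basis_words J" "w = q @ z" by (rule leading_word_has_basis_prefix)
      let ?g = "basis_elt J q * gen_word z"
      have g: "?g \<in> J" "leads ?g w"
        using J basis_elt[OF q(1)] basis_elt_poly[OF J q(1)] polys_gen_word
        by (auto simp: right_ideal_def q(2) intro: leads_mult_gen_word)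
      define c where "c = coeff_at r w / coeff_at ?g w"
      let ?r = "r - leavitt_scale c ?g"
      have cw: "coeff_at ?r w = 0"
        using g(2) by (simp add: coeff_at_diff coeff_at_scale c_def leads_def)
      have r: "?r \<in> J" using J g(1) less.prems
        by (auto simp: right_ideal_def intro!: leavitt.subspace_diff leavitt.subspace_scale)
      have "?r \<in> ?span"
      proof (cases "?r = 0")
        case False
        then obtain v where v: "leads ?r v"
          using r J ex_leads[of ?r] by (auto simp: right_ideal_def)
        then have "coeff_at r v \<noteq> 0 \<or> coeff_at ?g v \<noteq> 0"
          by (auto simp: leads_def coeff_at_diff coeff_at_scale)
        then have "word_index v \<le> word_index w" using w g(2) by (auto simp: leads_def)
        moreover have "word_index v \<noteq> word_index w"
          using v cw word_index_inject by (auto simp: leads_def)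
        ultimately have "word_index v < word_index w" by simp
        then show ?thesis using less.hyps[of ?r] r v idx[OF v] idx[OF w] by auto
      qed (simp add: leavitt.span_zero)
      moreover have "leavitt_scale c ?g \<in> ?span"
        using q(1) by (intro leavitt.span_scale leavitt.span_base) auto
      ultimately have "?r + leavitt_scale c ?g \<in> ?span" by (rule leavitt.span_add)
      then show "r \<in> ?span" by simp
    qed
  qed
  moreover have "r \<in> ?span \<or> (\<exists>w. leads r w)"
    using ex_leads[of r] assms by (cases "r = 0") (auto simp: leavitt.span_zero right_ideal_def)
  ultimately show ?thesis using assms(2) by blast
qed

text \<open>
  The coefficients are arbitrary elements of the Leavitt algebra; right multiplication by long words
  \<open>w\<close> turns them into polynomials.  The products \<open>basis_elt J q * gen_word u\<close> have the leading words \<open>q @ u\<close>, which are distinct because the basis words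
  are prefix-free.  Since the words \<open>w\<close> of a given length generate the unit ideal, a coefficient that
  they all annihilate is zero.
\<close>

lemma basis_independent:
  assumes J: "right_ideal J" and Q: "finite Q" "Q \<subseteq> basis_words J"
    and sum: "(\<Sum>q\<in>Q. basis_elt J q * a q) = 0" and q: "q \<in> Q"
  shows "a q = 0"
proof -
  obtain N where N: "\<forall>x\<in>a ` Q. \<forall>w. N \<le> length w \<longrightarrow> x * gen_word w \<in> polys"
    using ex_uniform_mult_gen_word_poly[of "a ` Q"] Q(1) by auto
  have "a q * gen_word w = 0" if w: "length w = N" for w
  proof -
    define d where "d q = a q * gen_word w" for q
    have d: "d q \<in> polys" if "q \<in> Q" for q using N w that by (auto simp: d_def)
    define T where "T = (\<Union>q\<in>Q. {u. coeff_at (d q) u \<noteq> 0})"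
    have T: "finite T" using Q(1) d by (auto simp: T_def intro!: finite_poly_support)
    have exp: "d q = (\<Sum>u\<in>T. leavitt_scale (coeff_at (d q) u) (gen_word u))" if qQ: "q \<in> Q" for q
    proof -
      obtain S where S: "finite S" "\<And>T. finite T \<Longrightarrow> S \<subseteq> T \<Longrightarrow>
          d q = (\<Sum>u\<in>T. leavitt_scale (coeff_at (d q) u) (gen_word u))"
        using poly_expansion[OF d[OF qQ]] by blast
      have "d q = (\<Sum>u\<in>S \<union> T. leavitt_scale (coeff_at (d q) u) (gen_word u))"
        using S(1) T by (intro S(2)) auto
      also have "\<dots> = (\<Sum>u\<in>T. leavitt_scale (coeff_at (d q) u) (gen_word u))"
        using S(1) T qQ by (intro sum.mono_neutral_right) (auto simp: T_def)
      finally show ?thesis .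
    qed
    have "(\<Sum>(q, u)\<in>Q \<times> T. leavitt_scale (coeff_at (d q) u) (basis_elt J q * gen_word u)) =
        (\<Sum>q\<in>Q. basis_elt J q * d q)"
      unfolding sum.cartesian_product[symmetric]
    proof (intro sum.cong refl)
      fix q assume "q \<in> Q"
      show "(\<Sum>u\<in>T. leavitt_scale (coeff_at (d q) u) (basis_elt J q * gen_word u)) =
          basis_elt J q * d q"
        by (subst (2) exp[OF \<open>q \<in> Q\<close>]) (simp add: sum_distrib_left)
    qed
    also have "\<dots> = (\<Sum>q\<in>Q. basis_elt J q * a q) * gen_word w"
      by (simp add: d_def sum_distrib_right mult.assoc)
    also have "\<dots> = 0" by (simp add: sum)
    finally have 0: "(\<Sum>x\<in>Q \<times> T. leavitt_scale (coeff_at (d (fst x)) (snd x))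
        (basis_elt J (fst x) * gen_word (snd x))) = 0" by (simp add: case_prod_beta)
    have inj: "inj_on (\<lambda>x. fst x @ snd x) (Q \<times> T)"
    proof (rule inj_onI)
      fix x y assume xy: "x \<in> Q \<times> T" "y \<in> Q \<times> T" and eq: "fst x @ snd x = fst y @ snd y"
      then have "fst x \<in> basis_words J" "fst y \<in> basis_words J" using Q(2) by auto
      from basis_words_prefix_free[OF this eq] eq show "x = y" by (simp add: prod_eq_iff)
    qed
    have "coeff_at (d (fst x)) (snd x) = 0" if "x \<in> Q \<times> T" for x
      using that Q(2) J by (intro leads_independent[OF _ inj _ 0])
        (auto simp: Q(1) T intro!: leads_mult_gen_word basis_elt basis_elt_poly)
    then have "coeff_at (d q) u = 0" if "u \<in> T" for u using that q by fastforce
    then show "a q * gen_word w = 0" using exp[OF q] by (simp add: d_def)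
  qed
  then show ?thesis using expand_by_words[of "a q" N] by simp
qed

text \<open>
  Two right linear combinations of the same family over different finite sets are added by padding
  the coefficients with zeros.
\<close>

lemma right_combination_add:
  assumes "finite P" "finite Q"
  shows "(\<Sum>q\<in>P. g q * a q) + (\<Sum>q\<in>Q. g q * b q) =
    (\<Sum>q\<in>P \<union> Q. g q * ((if q \<in> P then a q else 0) + (if q \<in> Q then b q else 0)) :: 'r::ring_1)"
proof -
  have "(\<Sum>q\<in>P. g q * a q) = (\<Sum>q\<in>P \<union> Q. g q * (if q \<in> P then a q else 0))"
    "(\<Sum>q\<in>Q. g q * b q) = (\<Sum>q\<in>P \<union> Q. g q * (if q \<in> Q then b q else 0))"
    using assms by (auto intro!: sum.mono_neutral_cong_left)
  then show ?thesis by (simp add: distrib_left sum.distrib)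
qed

text \<open>
  If the extension of \<open>J\<close> to the Leavitt algebra is generated by \<open>e\<close>, the basis of \<open>J\<close> is a basis of
  that extension.  It is finite since the expression of \<open>e\<close> involves only finitely many basis
  elements \<open>basis_elt J q\<close>; expanding \<open>e * basis_elt J p = basis_elt J p\<close>, independence shows that \<open>p\<close>
  is one of these \<open>q\<close> and that the coefficients of \<open>e\<close> are the coordinate functions.
\<close>

lemma ideal_basis_copies:
  assumes J: "right_ideal J" and e: "\<And>r. r \<in> J \<Longrightarrow> e * r = r"
    and I: "finite I" "\<And>i. i \<in> I \<Longrightarrow> c i \<in> J" and sum: "e = (\<Sum>i\<in>I. c i * b i)"
  shows "\<exists>v. copies (basis_words J) 1 e (basis_elt J) v"
proof -
  let ?g = "basis_elt J" and ?P = "basis_words J"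
  \<comment> \<open>The right ideal of the Leavitt algebra that the basis elements generate.\<close>
  define X where "X = {x. \<exists>Q v. finite Q \<and> Q \<subseteq> ?P \<and> x = (\<Sum>q\<in>Q. ?g q * v q)}"
  have X0: "0 \<in> X" by (auto simp: X_def intro!: exI[of _ "{}"])
  have X_add: "x + y \<in> X" if xy: "x \<in> X" "y \<in> X" for x y
  proof -
    obtain P a Q b where "finite P" "P \<subseteq> ?P" "x = (\<Sum>q\<in>P. ?g q * a q)"
      "finite Q" "Q \<subseteq> ?P" "y = (\<Sum>q\<in>Q. ?g q * b q)"
      using xy by (auto simp: X_def)
    then show ?thesis
      unfolding X_def using right_combination_add[of P Q ?g a b]
      by (intro CollectI exI[of _ "P \<union> Q"]
          exI[of _ "\<lambda>q. (if q \<in> P then a q else 0) + (if q \<in> Q then b q else 0)"]) auto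
  qed
  have X_mult: "x * y \<in> X" if "x \<in> X" for x y
  proof -
    obtain Q a where "finite Q" "Q \<subseteq> ?P" "x = (\<Sum>q\<in>Q. ?g q * a q)"
      using \<open>x \<in> X\<close> by (auto simp: X_def)
    then show ?thesis
      unfolding X_def by (intro CollectI exI[of _ Q] exI[of _ "\<lambda>q. a q * y"])
        (simp add: sum_distrib_right mult.assoc)
  qed
  have "leavitt_scale c x \<in> X" if "x \<in> X" for c x
    using X_mult[OF that, of "leavitt_scale c 1"] by simp
  then have "leavitt.subspace X"
    using X0 X_add by (auto simp: leavitt.subspace_def)
  moreover have "?g q * gen_word z \<in> X" if "q \<in> ?P" for q z
    unfolding X_def using that
    by (intro CollectI exI[of _ "{q}"] exI[of _ "\<lambda>_. gen_word z"]) simp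
  then have "(\<lambda>(q, z). ?g q * gen_word z) ` (?P \<times> UNIV) \<subseteq> X" by auto
  ultimately have "leavitt.span ((\<lambda>(q, z). ?g q * gen_word z) ` (?P \<times> UNIV)) \<subseteq> X"
    by (intro leavitt.span_minimal)
  then have "J \<subseteq> X" using right_ideal_subset_span[OF J] by blast
  then have cb: "c i * b i \<in> X" if "i \<in> I" for i using I(2)[OF that] X_mult by blast
  have "(\<Sum>i\<in>K. c i * b i) \<in> X" if "finite K" "K \<subseteq> I" for K
    using that by (induction K) (auto simp: X0 X_add cb)
  with I(1) have "e \<in> X" unfolding sum by blast
  then obtain Q v where Q: "finite Q" "Q \<subseteq> ?P" and ev: "e = (\<Sum>q\<in>Q. ?g q * v q)"
    by (auto simp: X_def)
  \<comment> \<open>The coefficients of basis_elt J p in e * basis_elt J p; the set insert p Q covers the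
    possibility, to be excluded, that p does not occur in the expression of e.\<close>
  have *: "(if q \<in> Q then v q * ?g p else 0) = (if q = p then 1 else 0)" if p: "p \<in> ?P" and q: "q \<in> insert p Q" for p q
  proof -
    have "(\<Sum>q\<in>Q. ?g q * (v q * ?g p)) + (\<Sum>q\<in>{p}. ?g q * (- 1)) = 0"
      using e[OF basis_elt(1)[OF p]] by (simp add: ev sum_distrib_right mult.assoc)
    then have "(\<Sum>q\<in>Q \<union> {p}. ?g q * ((if q \<in> Q then v q * ?g p else 0) + (if q \<in> {p} then - 1 else 0))) = 0"
      using Q(1) by (subst (asm) right_combination_add) auto
    then have "(if q \<in> Q then v q * ?g p else 0) + (if q \<in> {p} then - 1 else 0) = 0"
      using Q p q by (intro basis_independent[OF J, where Q = "Q \<union> {p}" and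
            a = "\<lambda>q. (if q \<in> Q then v q * ?g p else 0) + (if q \<in> {p} then - 1 else 0)"]) auto
    then show ?thesis by (auto split: if_splits)
  qed
  have "?P \<subseteq> Q"
  proof
    fix p assume "p \<in> ?P"
    from *[OF this, of p] show "p \<in> Q" by (auto split: if_splits)
  qed
  with Q(2) have "Q = ?P" by simp
  moreover have "v q * ?g p = (if q = p then 1 else 0)" if "q \<in> Q" "p \<in> Q" for p q
    using *[of p q] that \<open>Q = ?P\<close> by simp
  ultimately have "copies ?P 1 e ?g v" using Q(1) ev by (intro copiesI) auto
  then show ?thesis by blast
qed

text \<open>
  Each leading word of length \<open>L\<close> has exactly one basis word \<open>q\<close> as a prefix, and each \<open>q\<close> is a prefix of
  \<open>CARD('n) ^ (L - length q)\<close> words of length \<open>L\<close>; this number is \<open>1\<close> modulo \<open>CARD('n) - 1\<close>.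
\<close>

lemma card_leading_words_cong:
  assumes J: "right_ideal J" and fin: "finite (basis_words J)"
    and L: "\<And>q. q \<in> basis_words J \<Longrightarrow> length q \<le> L"
  shows "[card {w \<in> leading_words J. length w = L} = card (basis_words J)] (mod (CARD('n) - 1))"
proof -
  have eq: "{w \<in> leading_words J. length w = L} =
      (\<Union>q\<in>basis_words J. (\<lambda>z. q @ z) ` {z. length z = L - length q})"
  proof (intro equalityI subsetI)
    fix w assume w: "w \<in> {w \<in> leading_words J. length w = L}"
    then obtain q z where "q \<in> basis_words J" "w = q @ z"
      using leading_word_has_basis_prefix[of w J] by auto
    with w show "w \<in> (\<Union>q\<in>basis_words J. (\<lambda>z. q @ z) ` {z. length z = L - length q})"
      by (intro UN_I[of q]) auto
  next
    fix w assume "w \<in> (\<Union>q\<in>basis_words J. (\<lambda>z. q @ z) ` {z. length z = L - length q})"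
    then obtain q z where "q \<in> basis_words J" "w = q @ z" "length z = L - length q" by auto
    then show "w \<in> {w \<in> leading_words J. length w = L}"
      using L[of q] leading_words_append[OF J, of q z] by (auto simp: basis_words_def)
  qed
  have card_append: "card ((\<lambda>z. q @ z) ` Z) = card Z" for q :: "'n list" and Z
    by (intro card_image) (auto simp: inj_on_def)
  have "card {w \<in> leading_words J. length w = L} = (\<Sum>q\<in>basis_words J. CARD('n) ^ (L - length q))"
    unfolding eq
  proof (subst card_UN_disjoint)
    show "\<forall>p\<in>basis_words J. \<forall>q\<in>basis_words J. p \<noteq> q \<longrightarrow>
        (\<lambda>z. p @ z) ` {z. length z = L - length p} \<inter> (\<lambda>z. q @ z) ` {z. length z = L - length q} = {}"
      by (auto dest: basis_words_prefix_free)
  qed (auto simp: fin finite_words card_append card_words)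
  moreover have "[(\<Sum>q\<in>basis_words J. CARD('n) ^ (L - length q)) = (\<Sum>q\<in>basis_words J. 1 ^ (L - length q))]
      (mod (CARD('n) - 1))"
  proof (intro cong_sum cong_pow)
    show "[CARD('n) = 1] (mod (CARD('n) - 1))"
      by (simp add: cong_altdef_nat Suc_leI)
  qed
  ultimately show ?thesis by simp
qed

end

section \<open>Idempotents are free of unique rank modulo n - 1\<close>

text \<open>
  If \<open>K\<close> were smaller, padding both matrices with zeros to square matrices would give a product \<open>1\<close>
  in this order, hence also in the other order, where the product has a zero row.
\<close>

lemma card_le_of_left_inverse:
  fixes a :: "'i \<Rightarrow> 'j \<Rightarrow> 'k::field"
  assumes fin: "finite I" "finite K"
    and inv: "\<And>i j. i \<in> I \<Longrightarrow> j \<in> I \<Longrightarrow> (\<Sum>k\<in>K. a i k * b k j) = (if i = j then 1 else 0)"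
  shows "card I \<le> card K"
proof (rule ccontr)
  assume "\<not> card I \<le> card K"
  then have less: "card K < card I" by simp
  obtain f g where f: "bij_betw f {..<card I} I" and g: "bij_betw g {..<card K} K"
    using fin by (metis ex_bij_betw_nat_finite lessThan_atLeast0)
  let ?r = "card I"
  define A where "A = mat ?r ?r (\<lambda>(i, k). if k < card K then a (f i) (g k) else 0)"
  define B where "B = mat ?r ?r (\<lambda>(k, j). if k < card K then b (g k) (f j) else 0)"
  have carr: "A \<in> carrier_mat ?r ?r" "B \<in> carrier_mat ?r ?r" by (simp_all add: A_def B_def)
  have "A * B = 1\<^sub>m ?r"
  proof (rule eq_matI)
    fix i j assume ij: "i < dim_row (1\<^sub>m ?r :: 'k mat)" "j < dim_col (1\<^sub>m ?r :: 'k mat)"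
    have "(A * B) $$ (i, j) = (\<Sum>k\<in>{0..<?r}. if k < card K then a (f i) (g k) * b (g k) (f j) else 0)"
      using ij by (auto simp: A_def B_def scalar_prod_def intro!: sum.cong)
    also have "\<dots> = (\<Sum>k<card K. a (f i) (g k) * b (g k) (f j))"
      using less by (intro sum.mono_neutral_cong_right) auto
    also have "\<dots> = (\<Sum>k\<in>K. a (f i) k * b k (f j))"
      by (rule sum.reindex_bij_betw[OF g])
    also have "\<dots> = (if f i = f j then 1 else 0)"
      using ij f by (intro inv) (auto simp: bij_betw_def)
    also have "\<dots> = 1\<^sub>m ?r $$ (i, j)"
      using ij f by (auto simp: bij_betw_def inj_on_def)
    finally show "(A * B) $$ (i, j) = 1\<^sub>m ?r $$ (i, j)" .
  qed (simp_all add: A_def B_def)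
  then have "B * A = 1\<^sub>m ?r" by (rule mat_mult_left_right_inverse[OF carr])
  then have "(B * A) $$ (card K, card K) = 1" using less by simp
  moreover have "(B * A) $$ (card K, card K) = 0"
    using less by (simp add: A_def B_def scalar_prod_def)
  ultimately show False by simp
qed

context aperiodic_sequence
begin

lemma coeff_at_one: "coeff_at (1 :: ('k::field, 'n) leavitt) u = (if u = [] then 1 else 0)"
  using coeff_at_gen_word[of "[]" u, where 'a = 'k] by auto

text \<open>
  The products are the entries of the transition matrices between two bases of the same module.
  Taking constant coefficients is multiplicative on polynomials, so it turns the transition matrices
  into inverse matrices over the field.
\<close>

lemma copies_card_le:
  fixes e :: "('k::field, 'n) leavitt"
  assumes I: "copies I 1 e u v" and K: "copies K 1 e g h"
    and poly: "\<And>i k. i \<in> I \<Longrightarrow> k \<in> K \<Longrightarrow> v i * g k \<in> polys"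
      "\<And>i k. i \<in> I \<Longrightarrow> k \<in> K \<Longrightarrow> h k * u i \<in> polys"
  shows "card I \<le> card K"
proof (rule card_le_of_left_inverse[where a = "\<lambda>i k. coeff_at (v i * g k) []"
      and b = "\<lambda>k j. coeff_at (h k * u j) []"])
  show "finite I" "finite K" using I K by (simp_all add: copies_finite)
  fix i j assume ij: "i \<in> I" "j \<in> I"
  have "(\<Sum>k\<in>K. coeff_at (v i * g k) [] * coeff_at (h k * u j) []) =
      coeff_at (\<Sum>k\<in>K. v i * g k * (h k * u j)) []"
    using ij poly by (simp add: coeff_at_sum coeff_at_Nil_mult)
  also have "(\<Sum>k\<in>K. v i * g k * (h k * u j)) = v i * (\<Sum>k\<in>K. g k * h k) * u j"
    by (simp add: sum_distrib_left sum_distrib_right mult.assoc)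
  also have "\<dots> = (if i = j then 1 else 0)"
    using ij by (simp add: copies_sum[OF K] copies_unit_right[OF I] copies_orth[OF I])
  also have "coeff_at \<dots> [] = (if i = j then 1 else 0)"
    by (simp add: coeff_at_zero coeff_at_one)
  finally show "(\<Sum>k\<in>K. coeff_at (v i * g k) [] * coeff_at (h k * u j) []) = (if i = j then 1 else 0)" .
qed

definition fixed_ideal :: "('k::field, 'n) leavitt \<Rightarrow> ('k, 'n) leavitt set" where
  "fixed_ideal e = {r \<in> polys. e * r = r}"

lemma right_ideal_fixed_ideal: "right_ideal (fixed_ideal e)"
  by (auto simp: right_ideal_def fixed_ideal_def leavitt.subspace_def distrib_left mult.assoc[symmetric]
      intro: polys_zero polys_add polys_scale polys_mult)

text \<open>
  For an idempotent \<open>e\<close> the elements \<open>e * gen_word w\<close> with \<open>w\<close> of a fixed large length are polynomials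
  fixed by \<open>e\<close>, and \<open>e\<close> is a right linear combination of them.
\<close>

lemma idempotent_copies:
  assumes "e * e = e"
  shows "\<exists>v. copies (basis_words (fixed_ideal e)) 1 e (basis_elt (fixed_ideal e)) v"
proof -
  obtain N where N: "\<forall>w. N \<le> length w \<longrightarrow> e * gen_word w \<in> polys"
    using ex_mult_gen_word_poly by blast
  show ?thesis
  proof (rule ideal_basis_copies[OF right_ideal_fixed_ideal])
    show "e = (\<Sum>w | length w = N. e * gen_word w * gen_word_star w)" by (rule expand_by_words)
  qed (use N assms in \<open>auto simp: fixed_ideal_def finite_words mult.assoc[symmetric]\<close>)
qed

text \<open>
  Let \<open>M\<close> be the set of elements \<open>r = e * r\<close> whose coordinates \<open>v i * r\<close> are polynomials, which is the right ideal
  generated by the \<open>u i\<close> over the polynomials.  Its canonical basis has \<open>card I\<close> elements by invariance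
  of rank.  It is contained in \<open>fixed_ideal e\<close>, and it contains all \<open>r * gen_word z\<close> with \<open>r\<close> in the
  canonical basis of \<open>fixed_ideal e\<close> and \<open>z\<close> long.  So both have the same leading words of large length,
  and counting these words compares the two bases.
\<close>

lemma poly_copies_card_cong:
  assumes uv: "copies I 1 e u v" and poly: "\<And>i. i \<in> I \<Longrightarrow> u i \<in> polys"
  shows "[card I = card (basis_words (fixed_ideal e))] (mod (CARD('n) - 1))"
proof -
  let ?J = "fixed_ideal e"
  define M where "M = {r. e * r = r \<and> (\<forall>i\<in>I. v i * r \<in> polys)}"
  have expand: "r = (\<Sum>i\<in>I. u i * (v i * r))" if "e * r = r" for r
  proof -
    have "r = (\<Sum>i\<in>I. u i * v i) * r" by (simp add: copies_sum[OF uv] that)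
    then show ?thesis by (simp add: sum_distrib_right mult.assoc)
  qed
  have M_poly: "r \<in> polys" if r: "r \<in> M" for r
  proof -
    have "(\<Sum>i\<in>I. u i * (v i * r)) \<in> polys"
    proof (rule polys_sum)
      show "u i * (v i * r) \<in> polys" if "i \<in> I" for i
        using r poly[OF that] that by (intro polys_mult[of "u i" "v i * r"]) (auto simp: M_def)
    qed
    then show ?thesis using expand[of r] r by (simp add: M_def)
  qed
  then have MJ: "M \<subseteq> ?J" by (auto simp: fixed_ideal_def M_def)
  have M: "right_ideal M"
    unfolding right_ideal_def
  proof (intro conjI ballI subsetI M_poly)
    show "leavitt.subspace M"
      by (auto simp: M_def leavitt.subspace_def distrib_left intro: polys_zero polys_add polys_scale)
    show "r * d \<in> M" if "r \<in> M" "d \<in> polys" for r d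
      using that by (auto simp: M_def mult.assoc[symmetric] intro: polys_mult)
  qed
  have uM: "u i \<in> M" if "i \<in> I" for i
    using that copies_unit_left[OF uv] polys_one polys_zero by (auto simp: M_def copies_orth[OF uv])
  obtain h where h: "copies (basis_words M) 1 e (basis_elt M) h"
    using ideal_basis_copies[OF M _ copies_finite[OF uv] uM copies_sum[OF uv, symmetric]]
    by (auto simp: M_def)
  have h_poly: "h q * r \<in> polys" if q: "q \<in> basis_words M" and "r \<in> M" for q r
  proof -
    have "h q * (basis_elt M p * gen_word z) \<in> polys" if "p \<in> basis_words M" for p z
      using q that by (simp add: mult.assoc[symmetric] copies_orth[OF h] polys_gen_word polys_zero)
    moreover have "leavitt.subspace {r. h q * r \<in> polys}"
      by (auto simp: leavitt.subspace_def distrib_left intro: polys_zero polys_add polys_scale)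
    ultimately have "leavitt.span ((\<lambda>(q, z). basis_elt M q * gen_word z) ` (basis_words M \<times> UNIV))
        \<subseteq> {r. h q * r \<in> polys}"
      by (intro leavitt.span_minimal) auto
    then show ?thesis using right_ideal_subset_span[OF M \<open>r \<in> M\<close>] by blast
  qed
  have "card I = card (basis_words M)"
  proof (rule antisym)
    show "card I \<le> card (basis_words M)"
      using basis_elt(1) uM by (intro copies_card_le[OF uv h] h_poly) (auto simp: M_def)
    show "card (basis_words M) \<le> card I"
      using basis_elt(1) uM by (intro copies_card_le[OF h uv] h_poly) (auto simp: M_def)
  qed
  moreover obtain h' where h': "copies (basis_words ?J) 1 e (basis_elt ?J) h'"
    using idempotent_copies[OF copies_idem[OF uv]] by blast
  have fin: "finite (basis_words M)" "finite (basis_words ?J)"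
    using h h' by (auto dest: copies_finite)
  obtain N where N: "\<forall>x\<in>(\<lambda>(i, q). v i * basis_elt ?J q) ` (I \<times> basis_words ?J).
      \<forall>w. N \<le> length w \<longrightarrow> x * gen_word w \<in> polys"
    using ex_uniform_mult_gen_word_poly[of "(\<lambda>(i, q). v i * basis_elt ?J q) ` (I \<times> basis_words ?J)"]
      fin(2) copies_finite[OF uv] by blast
  define L where "L = N + Max (insert 0 (length ` (basis_words M \<union> basis_words ?J)))"
  have L: "N + length q \<le> L" if "q \<in> basis_words M \<or> q \<in> basis_words ?J" for q
    unfolding L_def using fin that by (intro add_left_mono Max_ge) auto
  have "w \<in> leading_words M" if w: "w \<in> leading_words ?J" "length w = L" for w
  proof -
    obtain q z where q: "q \<in> basis_words ?J" "w = q @ z"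
      using leading_word_has_basis_prefix[OF w(1)] .
    have "N \<le> length z" using L[of q] q w(2) by simp
    then have "basis_elt ?J q * gen_word z \<in> M"
      using N q(1) basis_elt(1)[OF q(1)] by (auto simp: M_def fixed_ideal_def mult.assoc[symmetric])
    moreover have "leads (basis_elt ?J q * gen_word z) w"
      unfolding q(2) using q(1) basis_elt_poly[OF right_ideal_fixed_ideal]
      by (intro leads_mult_gen_word basis_elt)
    ultimately show ?thesis by (auto simp: leading_words_def)
  qed
  with MJ have "{w \<in> leading_words M. length w = L} = {w \<in> leading_words ?J. length w = L}"
    by (auto simp: leading_words_def)
  moreover have "[card {w \<in> leading_words M. length w = L} = card (basis_words M)] (mod (CARD('n) - 1))"
    using L by (intro card_leading_words_cong[OF M fin(1)]) fastforce
  moreover have "[card {w \<in> leading_words ?J. length w = L} = card (basis_words ?J)] (mod (CARD('n) - 1))"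
    using L by (intro card_leading_words_cong[OF right_ideal_fixed_ideal fin(2)]) fastforce
  ultimately show ?thesis by (metis cong_sym cong_trans)
qed

text \<open>
  Splitting each basis element along all words of length \<open>N\<close> makes the basis polynomial and
  multiplies the number of its elements by a power of \<open>CARD('n)\<close>.
\<close>

lemma copies_card_cong_basis:
  assumes uv: "copies I 1 e u v"
  shows "[card I = card (basis_words (fixed_ideal e))] (mod (CARD('n) - 1))"
proof -
  obtain N where N: "\<forall>x\<in>u ` I. \<forall>w. N \<le> length w \<longrightarrow> x * gen_word w \<in> polys"
    using ex_uniform_mult_gen_word_poly[of "u ` I"] copies_finite[OF uv] by blast
  let ?W = "{w :: 'n list. length w = N}"
  have "copies ?W 1 1 gen_word gen_word_star"
    using copies_words[of ?W N] by (simp add: sum_gen_word_gen_word_star)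
  from poly_copies_card_cong[OF copies_compose[OF uv this]]
  have "[card (I \<times> ?W) = card (basis_words (fixed_ideal e))] (mod (CARD('n) - 1))"
    using N by auto
  moreover have "[card I * CARD('n) ^ N = card I * 1 ^ N] (mod (CARD('n) - 1))"
    by (intro cong_mult cong_pow cong_refl) (simp add: cong_altdef_nat Suc_leI)
  ultimately show ?thesis
    by (simp add: card_cartesian_product card_words) (metis cong_sym cong_trans)
qed

end

text \<open>
  Both bases of \<open>eL\<close> are compared with the one that comes from the leading words of polynomials in \<open>eL\<close>.
\<close>

theorem copies_card_cong:
  fixes e :: "('k::field, 'n::finite) leavitt"
  assumes "1 < CARD('n)" "copies I 1 e u v" "copies K 1 e u' v'"
  shows "[card I = card K] (mod (CARD('n) - 1))"
proof -
  obtain \<xi> :: "nat \<Rightarrow> 'n" where "aperiodic_sequence \<xi>"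
    using ex_aperiodic_sequence[OF assms(1)] by blast
  then interpret aperiodic_sequence \<xi> .
  show ?thesis
    using copies_card_cong_basis[OF assms(2)] copies_card_cong_basis[OF assms(3)]
    by (metis cong_sym cong_trans)
qed

text \<open>
  The projective module \<open>eL\<close> is free: a basis of the right ideal of the polynomials in \<open>eL\<close> is a basis of \<open>eL\<close>.
\<close>

theorem ex_copies_of_idempotent:
  fixes e :: "('k::field, 'n::finite) leavitt"
  assumes "1 < CARD('n)" "e * e = e"
  shows "\<exists>(I :: 'n list set) u v. copies I 1 e u v"
proof -
  obtain \<xi> :: "nat \<Rightarrow> 'n" where "aperiodic_sequence \<xi>"
    using ex_aperiodic_sequence[OF assms(1)] by blast
  then interpret aperiodic_sequence \<xi> .
  show ?thesis using idempotent_copies[OF assms(2)] by blast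
qed

section \<open>Simplicity\<close>

context aperiodic_sequence
begin

text \<open>
  A polynomial \<open>r \<noteq> 0\<close> is obtained from \<open>a\<close> by right multiplication with a long word.  Let \<open>u\<close> be a shortest
  word occurring in \<open>r\<close>, and let \<open>w = x\<^sup>M y\<close> for distinct letters \<open>x\<close>, \<open>y\<close> and \<open>M\<close> at least the length of every
  word of \<open>r\<close>.  Multiplying by \<open>gen_word_star (u @ w)\<close> and \<open>gen_word w\<close> isolates the coefficient of \<open>u\<close>:
  for another word \<open>v\<close> of \<open>r\<close>, \<open>u @ w\<close> is not a prefix of \<open>v @ w\<close>, as the letter \<open>y\<close> would meet a letter \<open>x\<close>.
\<close>

lemma ex_mult_eq_one:
  fixes a :: "('k::field, 'n) leavitt"
  assumes n: "1 < CARD('n)" and "a \<noteq> 0"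
  shows "\<exists>b c. b * a * c = 1"
proof -
  obtain x y :: 'n where xy: "x \<noteq> y"
    using n card_le_Suc0_iff_eq[of "UNIV :: 'n set"] by auto
  obtain N where N: "\<forall>w. N \<le> length w \<longrightarrow> a * gen_word w \<in> polys"
    using ex_mult_gen_word_poly by blast
  have "\<exists>w0. length w0 = N \<and> a * gen_word w0 \<noteq> 0"
  proof (rule ccontr)
    assume "\<nexists>w0. length w0 = N \<and> a * gen_word w0 \<noteq> 0"
    then have "(\<Sum>w | length w = N. a * gen_word w * gen_word_star w) = 0"
      by (intro sum.neutral) auto
    then show False using expand_by_words[of a N] assms(2) by simp
  qed
  then obtain w0 where w0: "length w0 = N" "a * gen_word w0 \<noteq> 0" by blast
  define r where "r = a * gen_word w0"
  have r: "r \<in> polys" "r \<noteq> 0" using N w0 by (auto simp: r_def)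
  define S where "S = {u. coeff_at r u \<noteq> 0}"
  have S: "finite S" "S \<noteq> {}"
    using finite_poly_support[OF r(1)] poly_eq_zero[OF r(1)] r(2) by (auto simp: S_def)
  obtain u where u: "u \<in> S" and min: "\<And>v. v \<in> S \<Longrightarrow> length u \<le> length v"
    using S(2) ex_has_least_nat[of "\<lambda>u. u \<in> S" _ length] by blast
  define M where "M = Max (length ` S)"
  have M: "length v \<le> M" if "v \<in> S" for v using S(1) that by (simp add: M_def)
  define w where "w = replicate M x @ [y]"
  have cancel: "gen_word_star (u @ w) * gen_word (v @ w) = (if v = u then 1 else 0 :: ('k, 'n) leavitt)"
    if v: "v \<in> S" for v
  proof (cases "v = u")
    case True
    then show ?thesis using gen_word_star_append_cancel[of "u @ w" "[]"] by simp
  next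
    case False
    have "\<not> prefix (u @ w) (v @ w)"
    proof
      assume "prefix (u @ w) (v @ w)"
      then obtain t where t: "v @ w = u @ w @ t" by (auto simp: prefix_def)
      have len: "length v = length u + length t" using arg_cong[OF t, of length] by simp
      show False
      proof (cases "t = []")
        case True
        with t False show False by simp
      next
        case t_ne: False
        have le: "length t \<le> M" using M[OF v] len by simp
        have "(v @ w) ! (length u + M) = w ! (M - length t)"
          using len le by (simp add: nth_append)
        also have "\<dots> = x"
        proof -
          have "M - length t < M" using t_ne le length_greater_0_conv[of t] by linarith
          then show ?thesis by (simp add: w_def nth_append)
        qed
        finally have "(v @ w) ! (length u + M) = x" .
        moreover have "(u @ w @ t) ! (length u + M) = y" by (simp add: w_def nth_append)
        ultimately show False using t xy by simp
      qed
    qed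
    with False show ?thesis using min[OF v] by (simp add: gen_word_star_gen_word)
  qed
  obtain T where T: "finite T"
    "\<And>T'. finite T' \<Longrightarrow> T \<subseteq> T' \<Longrightarrow> r = (\<Sum>u\<in>T'. leavitt_scale (coeff_at r u) (gen_word u))"
    using poly_expansion[OF r(1)] by blast
  have "r = (\<Sum>v\<in>T \<union> S. leavitt_scale (coeff_at r v) (gen_word v))"
    using T(1) S(1) by (intro T(2)) auto
  also have "\<dots> = (\<Sum>v\<in>S. leavitt_scale (coeff_at r v) (gen_word v))"
    using T(1) S(1) by (intro sum.mono_neutral_right) (auto simp: S_def)
  finally have "gen_word_star (u @ w) * r * gen_word w =
      gen_word_star (u @ w) * (\<Sum>v\<in>S. leavitt_scale (coeff_at r v) (gen_word v)) * gen_word w"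
    by simp
  also have "\<dots> = (\<Sum>v\<in>S. leavitt_scale (coeff_at r v) (gen_word_star (u @ w) * gen_word (v @ w)))"
    by (simp add: sum_distrib_left sum_distrib_right gen_word_append mult.assoc)
  also have "\<dots> = (\<Sum>v\<in>S. if v = u then leavitt_scale (coeff_at r v) 1 else 0)"
    by (intro sum.cong refl) (simp add: cancel)
  also have "\<dots> = leavitt_scale (coeff_at r u) 1"
    using S(1) u by simp
  finally have "gen_word_star (u @ w) * r * gen_word w = leavitt_scale (coeff_at r u) 1" .
  then have "leavitt_scale (1 / coeff_at r u) (gen_word_star (u @ w)) * a * (gen_word w0 * gen_word w) = 1"
    using u by (simp add: r_def S_def mult.assoc)
  then show ?thesis by blast
qed

end

text \<open>
  This makes the Leavitt algebra simple: the two-sided ideal of a nonzero element contains \<open>1\<close>.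
\<close>

theorem leavitt_simple:
  fixes a :: "('k::field, 'n::finite) leavitt"
  assumes n: "1 < CARD('n)" and "a \<noteq> 0"
  shows "\<exists>b c. b * a * c = 1"
proof -
  obtain \<xi> :: "nat \<Rightarrow> 'n" where "aperiodic_sequence \<xi>"
    using ex_aperiodic_sequence[OF n] by blast
  then interpret aperiodic_sequence \<xi> .
  show ?thesis using assms by (rule ex_mult_eq_one)
qed

section \<open>Homomorphisms from a Leavitt algebra to a corner\<close>

text \<open>
  The product of the images of the letters, with \<open>p\<close> as the empty product; \<open>p\<close> is the unit of the
  corner in which the images lie.
\<close>

definition word_eval ::
  "('m \<Rightarrow> 'a) \<Rightarrow> ('m \<Rightarrow> 'a) \<Rightarrow> 'a \<Rightarrow> 'm symbol word \<Rightarrow> 'a::ring_1" where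
  "word_eval y z p u = foldr (\<lambda>s a. (case s of Sym i \<Rightarrow> y i | SymStar i \<Rightarrow> z i) * a) (letters u) p"

definition free_eval ::
  "('m \<Rightarrow> ('k, 'n) leavitt) \<Rightarrow> ('m \<Rightarrow> ('k, 'n) leavitt) \<Rightarrow> ('k, 'n) leavitt \<Rightarrow>
     ('k, 'm) free_algebra \<Rightarrow> ('k::field, 'n::finite) leavitt" where
  "free_eval y z p q = (\<Sum>u\<in>Poly_Mapping.keys q. leavitt_scale (Poly_Mapping.lookup q u) (word_eval y z p u))"

context
  fixes y z :: "'m::finite \<Rightarrow> ('k::field, 'n::finite) leavitt" and p :: "('k, 'n) leavitt"
  assumes yz: "copies UNIV p p y z"
begin

lemma unit_mult_word_eval: "p * word_eval y z p u = word_eval y z p u"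
proof -
  have "p * y i = y i" "p * z i = z i" for i
    using copies_unit_left[OF yz] copies_left[OF yz] by auto
  then show ?thesis
    by (cases "letters u")
      (auto simp: word_eval_def copies_idem[OF yz] mult.assoc[symmetric] split: symbol.split)
qed

lemma word_eval_plus: "word_eval y z p (u + v) = word_eval y z p u * word_eval y z p v"
proof -
  have "foldr (\<lambda>s a. (case s of Sym i \<Rightarrow> y i | SymStar i \<Rightarrow> z i) * a) ss (word_eval y z p v) =
      foldr (\<lambda>s a. (case s of Sym i \<Rightarrow> y i | SymStar i \<Rightarrow> z i) * a) ss p * word_eval y z p v" for ss
    by (induction ss) (simp_all add: unit_mult_word_eval mult.assoc)
  then show ?thesis by (simp add: word_eval_def plus_word_def)
qed

lemma free_eval_superset:
  assumes "finite A" "Poly_Mapping.keys q \<subseteq> A"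
  shows "free_eval y z p q = (\<Sum>u\<in>A. leavitt_scale (Poly_Mapping.lookup q u) (word_eval y z p u))"
  unfolding free_eval_def using assms
  by (intro sum.mono_neutral_left) (auto simp: in_keys_iff)

lemma free_eval_add: "free_eval y z p (q + r) = free_eval y z p q + free_eval y z p r"
proof -
  let ?A = "Poly_Mapping.keys q \<union> Poly_Mapping.keys r"
  have "free_eval y z p (q + r) =
      (\<Sum>u\<in>?A. leavitt_scale (Poly_Mapping.lookup (q + r) u) (word_eval y z p u))"
    by (rule free_eval_superset) (auto simp: Poly_Mapping.keys_add)
  then show ?thesis
    by (simp add: lookup_add leavitt.scale_left_distrib sum.distrib free_eval_superset[of ?A])
qed

lemma free_eval_zero: "free_eval y z p 0 = 0"
  by (simp add: free_eval_def)

lemma free_eval_diff: "free_eval y z p (q - r) = free_eval y z p q - free_eval y z p r"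
  using free_eval_add[of "q - r" r] by simp

lemma free_eval_sum: "free_eval y z p (\<Sum>i\<in>A. h i) = (\<Sum>i\<in>A. free_eval y z p (h i))"
  by (induction A rule: infinite_finite_induct) (simp_all add: free_eval_zero free_eval_add)

lemma free_eval_single:
  "free_eval y z p (Poly_Mapping.single u c) = leavitt_scale c (word_eval y z p u)"
  by (cases "c = 0") (simp_all add: free_eval_def)

lemma free_eval_one: "free_eval y z p 1 = p"
  unfolding single_one[symmetric] free_eval_single by (simp add: word_eval_def zero_word_def)

lemma free_eval_mult: "free_eval y z p (q * r) = free_eval y z p q * free_eval y z p r"
proof (induction q rule: poly_mapping_single_induct)
  case (single u c)
  show ?case
    by (induction r rule: poly_mapping_single_induct)
      (simp_all add: mult_single free_eval_single word_eval_plus distrib_left free_eval_add mult.commute)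
qed (simp add: distrib_right free_eval_add)

lemma free_eval_relation:
  assumes "r \<in> leavitt_relations"
  shows "free_eval y z p r = 0"
proof -
  have x: "free_eval y z p (free_x i) = y i" for i
    by (simp add: free_x_def free_eval_single word_eval_def copies_right[OF yz])
  have xs: "free_eval y z p (free_xstar i) = z i" for i
    by (simp add: free_xstar_def free_eval_single word_eval_def copies_unit_right[OF yz])
  show ?thesis
    using assms unfolding leavitt_relations_def
    by (auto simp: free_eval_diff free_eval_sum free_eval_mult x xs free_eval_one free_eval_zero
        copies_sum[OF yz] copies_orth[OF yz])
qed

lemma free_eval_ideal: "q \<in> two_sided_ideal leavitt_relations \<Longrightarrow> free_eval y z p q = 0"
  by (induction rule: two_sided_ideal.induct)
    (simp_all add: free_eval_zero free_eval_add free_eval_mult free_eval_relation)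

text \<open>
  The universal property of the Leavitt algebra, for corners: its defining relations say that the unit
  is the sum of \<open>CARD('m)\<close> copies of itself, so an idempotent \<open>p\<close> that is the sum of \<open>CARD('m)\<close> copies of
  itself gives a homomorphism that sends \<open>1\<close> to \<open>p\<close>.
\<close>

theorem ex_leavitt_corner_hom:
  obtains \<phi> :: "('k, 'm) leavitt \<Rightarrow> ('k, 'n) leavitt" where
    "\<And>a b. \<phi> (a + b) = \<phi> a + \<phi> b" "\<And>a b. \<phi> (a * b) = \<phi> a * \<phi> b"
    "\<And>c a. \<phi> (leavitt_scale c a) = leavitt_scale c (\<phi> a)" "\<phi> 1 = p"
proof
  let ?\<phi> = "\<lambda>a. free_eval y z p (rep_leavitt a)"
  have abs: "?\<phi> (abs_leavitt q) = free_eval y z p q" for q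
  proof -
    have "leavitt_rel (rep_leavitt (abs_leavitt q)) q"
      by (rule Quotient_rep_abs[OF Quotient_leavitt leavitt_rel_eqI[OF refl]])
    then have "free_eval y z p (rep_leavitt (abs_leavitt q) - q) = 0"
      unfolding leavitt_rel_def by (rule free_eval_ideal)
    then show ?thesis by (simp add: free_eval_diff)
  qed
  show "?\<phi> (a + b) = ?\<phi> a + ?\<phi> b" for a b
    by (induction a rule: leavitt.abs_induct, induction b rule: leavitt.abs_induct)
      (simp add: plus_leavitt.abs_eq abs free_eval_add)
  show "?\<phi> (a * b) = ?\<phi> a * ?\<phi> b" for a b
    by (induction a rule: leavitt.abs_induct, induction b rule: leavitt.abs_induct)
      (simp add: times_leavitt.abs_eq abs free_eval_mult)
  show "?\<phi> 1 = p" by (simp add: one_leavitt.abs_eq abs free_eval_one)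
  have "free_eval y z p (free_const c * q) = leavitt_scale c (free_eval y z p q)" for c q
  proof (induction q rule: poly_mapping_single_induct)
    case (single u d)
    then show ?case by (simp add: free_const_def mult_single free_eval_single)
  next
    case (add q r)
    then show ?case by (simp add: distrib_left free_eval_add leavitt.scale_right_distrib)
  qed
  then show "?\<phi> (leavitt_scale c a) = leavitt_scale c (?\<phi> a)" for c a
    by (induction a rule: leavitt.abs_induct) (simp add: leavitt_scale.abs_eq abs)
qed

end

lemma leavitt_hom_inj:
  fixes \<phi> :: "('k::field, 'm::finite) leavitt \<Rightarrow> 'a::ring_1"
  assumes m: "1 < CARD('m)"
    and add: "\<And>a b. \<phi> (a + b) = \<phi> a + \<phi> b" and mult: "\<And>a b. \<phi> (a * b) = \<phi> a * \<phi> b"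
    and one: "\<phi> 1 \<noteq> 0"
  shows "inj \<phi>"
proof (rule injI, rule ccontr)
  fix a b assume eq: "\<phi> a = \<phi> b" and "a \<noteq> b"
  then obtain c d where "c * (a - b) * d = 1" using leavitt_simple[OF m, of "a - b"] by auto
  moreover have "\<phi> (a - b) = 0" using add[of "a - b" b] eq by simp
  ultimately show False using one mult by (metis mult_zero_left mult_zero_right)
qed

section \<open>Matrix rings as corners\<close>

text \<open>
  For \<open>copies {..<t} p e u v\<close>, on matrices with entries in the corner \<open>pRp\<close>, this is the isomorphism of
  the \<open>t \<times> t\<close> matrices over \<open>pRp\<close> with the corner \<open>eRe\<close>.
\<close>

definition corner :: "(nat \<Rightarrow> 'a) \<Rightarrow> (nat \<Rightarrow> 'a) \<Rightarrow> nat \<Rightarrow> 'a mat \<Rightarrow> 'a::ring_1" where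
  "corner u v t M = (\<Sum>i<t. \<Sum>j<t. u i * M $$ (i, j) * v j)"

lemma corner_add:
  assumes "M \<in> carrier_mat t t" "N \<in> carrier_mat t t"
  shows "corner u v t (M + N) = corner u v t M + corner u v t N"
  using assms by (simp add: corner_def distrib_left distrib_right sum.distrib)

lemma index_mult_square_mat:
  assumes "M \<in> carrier_mat t t" "N \<in> carrier_mat t t" "i < t" "j < t"
  shows "(M * N) $$ (i, j) = (\<Sum>k<t. M $$ (i, k) * N $$ (k, j))"
  using assms by (auto simp: scalar_prod_def lessThan_atLeast0 intro!: sum.cong)

lemma corner_mult:
  assumes uv: "copies {..<t} p e u v" and M: "M \<in> carrier_mat t t" and N: "N \<in> carrier_mat t t"
    and p: "\<And>i j. i < t \<Longrightarrow> j < t \<Longrightarrow> p * N $$ (i, j) = N $$ (i, j)"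
  shows "corner u v t (M * N) = corner u v t M * corner u v t N"
proof -
  have inner: "(\<Sum>j<t. u i * M $$ (i, j) * v j) * (\<Sum>i'<t. \<Sum>k<t. u i' * N $$ (i', k) * v k) =
      (\<Sum>k<t. u i * (M * N) $$ (i, k) * v k)" if i: "i < t" for i
  proof -
    have "(\<Sum>j<t. u i * M $$ (i, j) * v j) * (\<Sum>i'<t. \<Sum>k<t. u i' * N $$ (i', k) * v k) =
        (\<Sum>j<t. \<Sum>i'<t. u i * M $$ (i, j) * ((v j * u i') * (\<Sum>k<t. N $$ (i', k) * v k)))"
      by (simp only: sum_product) (simp only: sum_distrib_left mult.assoc)
    also have "\<dots> = (\<Sum>j<t. u i * M $$ (i, j) * (\<Sum>k<t. N $$ (j, k) * v k))"
    proof (intro sum.cong refl)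
      fix j assume j: "j \<in> {..<t}"
      have "(\<Sum>i'<t. u i * M $$ (i, j) * ((v j * u i') * (\<Sum>k<t. N $$ (i', k) * v k))) =
          u i * M $$ (i, j) * (\<Sum>i'<t. (if j = i' then p else 0) * (\<Sum>k<t. N $$ (i', k) * v k))"
        unfolding sum_distrib_left[of "u i * M $$ (i, j)"]
        using j by (intro sum.cong refl) (simp add: copies_orth[OF uv])
      also have "\<dots> = u i * M $$ (i, j) * (p * (\<Sum>k<t. N $$ (j, k) * v k))"
        using j by (subst sum_mult_if_eq) simp_all
      also have "p * (\<Sum>k<t. N $$ (j, k) * v k) = (\<Sum>k<t. N $$ (j, k) * v k)"
        using j by (simp add: sum_distrib_left mult.assoc[symmetric] p)
      finally show "(\<Sum>i'<t. u i * M $$ (i, j) * ((v j * u i') * (\<Sum>k<t. N $$ (i', k) * v k))) =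
          u i * M $$ (i, j) * (\<Sum>k<t. N $$ (j, k) * v k)" .
    qed
    also have "\<dots> = (\<Sum>k<t. \<Sum>j<t. u i * M $$ (i, j) * (N $$ (j, k) * v k))"
      by (simp only: sum_distrib_left) (rule sum.swap)
    also have "\<dots> = (\<Sum>k<t. u i * (M * N) $$ (i, k) * v k)"
    proof (intro sum.cong refl)
      fix k assume "k \<in> {..<t}"
      then have "(M * N) $$ (i, k) = (\<Sum>j<t. M $$ (i, j) * N $$ (j, k))"
        using M N i by (intro index_mult_square_mat) auto
      then show "(\<Sum>j<t. u i * M $$ (i, j) * (N $$ (j, k) * v k)) = u i * (M * N) $$ (i, k) * v k"
        by (simp add: sum_distrib_left sum_distrib_right mult.assoc)
    qed
    finally show ?thesis .
  qed
  show ?thesis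
    unfolding corner_def
    by (subst sum_distrib_right, rule sum.cong[OF refl], rule inner[symmetric]) simp
qed

lemma corner_diagonal:
  assumes uv: "copies {..<t} p e u v"
    and M: "\<And>i j. i < t \<Longrightarrow> j < t \<Longrightarrow> M $$ (i, j) = (if i = j then p else 0)"
  shows "corner u v t M = e"
proof -
  have "corner u v t M = (\<Sum>i<t. \<Sum>j<t. if i = j then u i * p * v j else 0)"
    unfolding corner_def by (intro sum.cong refl) (simp add: M)
  also have "\<dots> = (\<Sum>i<t. u i * v i)"
    by (simp add: copies_right[OF uv])
  finally show ?thesis by (simp add: copies_sum[OF uv])
qed

lemma corner_unit:
  assumes uv: "copies {..<t} p e u v"
  shows "e * corner u v t M = corner u v t M" "corner u v t M * e = corner u v t M"
  by (simp_all add: corner_def sum_distrib_left sum_distrib_right mult.assoc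
      copies_unit_right[OF uv]) (simp add: mult.assoc[symmetric] copies_unit_left[OF uv])

lemma corner_entry:
  assumes uv: "copies {..<t} p e u v" and ij: "i < t" "j < t"
  shows "v i * corner u v t M * u j = p * M $$ (i, j) * p"
proof -
  have "v i * corner u v t M * u j = (\<Sum>a<t. \<Sum>b<t. (v i * u a) * (M $$ (a, b) * (v b * u j)))"
    by (simp add: corner_def sum_distrib_left sum_distrib_right mult.assoc)
  also have "\<dots> = (\<Sum>a<t. (if i = a then p else 0) * (\<Sum>b<t. M $$ (a, b) * (if b = j then p else 0)))"
    using ij by (simp add: copies_orth[OF uv] sum_distrib_left)
  also have "\<dots> = p * M $$ (i, j) * p"
    using ij by (simp add: sum_mult_if_eq mult.assoc)
  finally show ?thesis .
qed

lemma corner_entries: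
  assumes uv: "copies {..<t} 1 e u v" and a: "e * a = a" "a * e = a"
  shows "corner u v t (mat t t (\<lambda>(i, j). v i * a * u j)) = a"
proof -
  have "corner u v t (mat t t (\<lambda>(i, j). v i * a * u j)) =
      (\<Sum>i<t. \<Sum>j<t. (u i * v i * a) * (u j * v j))"
    by (simp add: corner_def mult.assoc)
  also have "\<dots> = (\<Sum>i<t. u i * v i * a) * (\<Sum>j<t. u j * v j)"
    by (simp only: sum_product)
  also have "\<dots> = a"
    by (simp only: sum_distrib_right[symmetric] copies_sum[OF uv] a)
  finally show ?thesis .
qed

lemma ring_hom_matD:
  fixes f :: "'a::ring_1 mat \<Rightarrow> 'b::ring_1 mat"
  assumes "f \<in> ring_hom (ring_mat TYPE('a) s ()) (ring_mat TYPE('b) t ())"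
  shows "X \<in> carrier_mat s s \<Longrightarrow> f X \<in> carrier_mat t t"
    and "X \<in> carrier_mat s s \<Longrightarrow> Y \<in> carrier_mat s s \<Longrightarrow> f (X + Y) = f X + f Y"
    and "X \<in> carrier_mat s s \<Longrightarrow> Y \<in> carrier_mat s s \<Longrightarrow> f (X * Y) = f X * f Y"
    and "f (1\<^sub>m s) = 1\<^sub>m t"
  using assms by (auto simp: ring_hom_def ring_mat_simps)

definition elem_mat :: "nat \<Rightarrow> nat \<Rightarrow> nat \<Rightarrow> 'a \<Rightarrow> 'a::zero mat" where
  "elem_mat s a b x = mat s s (\<lambda>(i, j). if i = a \<and> j = b then x else 0)"

lemma elem_mat_carrier: "elem_mat s a b x \<in> carrier_mat s s"
  by (simp add: elem_mat_def)

lemma elem_mat_add: "elem_mat s a b x + elem_mat s a b y = elem_mat s a b (x + y :: 'a::ring_1)"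
  by (rule eq_matI) (auto simp: elem_mat_def)

lemma elem_mat_mult:
  assumes "b < s"
  shows "elem_mat s a b x * elem_mat s c d y = elem_mat s a d (if b = c then x * y else (0 :: 'a::ring_1))"
proof (rule eq_matI)
  fix i j assume "i < dim_row (elem_mat s a d (if b = c then x * y else 0))"
    "j < dim_col (elem_mat s a d (if b = c then x * y else 0))"
  then have ij: "i < s" "j < s" by (simp_all add: elem_mat_def)
  then have "(elem_mat s a b x * elem_mat s c d y) $$ (i, j) =
      (\<Sum>k<s. elem_mat s a b x $$ (i, k) * elem_mat s c d y $$ (k, j))"
    by (simp add: index_mult_square_mat elem_mat_carrier)
  also have "\<dots> = (\<Sum>k<s. if k = b then (if i = a then x else 0) * (if b = c \<and> j = d then y else 0) else 0)"
    using ij by (intro sum.cong refl) (auto simp: elem_mat_def)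
  also have "\<dots> = (if i = a then x else 0) * (if b = c \<and> j = d then y else 0)"
    using assms by simp
  finally show "(elem_mat s a b x * elem_mat s c d y) $$ (i, j) =
      elem_mat s a d (if b = c then x * y else 0) $$ (i, j)"
    using ij by (simp add: elem_mat_def)
qed (simp_all add: elem_mat_def)

text \<open>
  The induction runs over the diagonal matrices whose first \<open>r\<close> diagonal entries are \<open>1\<close>, which are the
  partial sums of the diagonal matrix units.
\<close>

lemma additive_one_mat:
  fixes g :: "'a::ring_1 mat \<Rightarrow> 'b::ring_1"
  assumes add: "\<And>X Y. X \<in> carrier_mat s s \<Longrightarrow> Y \<in> carrier_mat s s \<Longrightarrow> g (X + Y) = g X + g Y"
  shows "g (1\<^sub>m s) = (\<Sum>a<s. g (elem_mat s a a 1))"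
proof -
  let ?D = "\<lambda>r. mat s s (\<lambda>(i, j). if i = j \<and> i < r then 1 else (0 :: 'a))"
  have "g (?D r) = (\<Sum>a<r. g (elem_mat s a a 1))" for r
  proof (induction r)
    case 0
    have "?D 0 + ?D 0 = ?D 0" by (rule eq_matI) auto
    then have "g (?D 0) = g (?D 0) + g (?D 0)" using add[of "?D 0" "?D 0"] by simp
    then have "g (?D 0) = 0" by (simp only: add_cancel_right_right)
    then show ?case by (simp only: lessThan_0 sum.empty)
  next
    case (Suc r)
    have "?D (Suc r) = ?D r + elem_mat s r r 1"
      by (rule eq_matI) (auto simp: elem_mat_def less_Suc_eq)
    with Suc show ?case by (simp add: add elem_mat_carrier)
  qed
  from this[of s] have "g (?D s) = (\<Sum>a<s. g (elem_mat s a a 1))" .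
  moreover have "?D s = 1\<^sub>m s" by (rule eq_matI) auto
  ultimately show ?thesis by simp
qed

section \<open>The embedding criterion\<close>

text \<open>
  Identify the target with a corner \<open>eLe\<close>, where \<open>e\<close> is a sum of \<open>t\<close> copies of \<open>1\<close>, and let \<open>p\<close> be the image of
  the first diagonal matrix unit.  The matrix units exhibit \<open>e\<close> as \<open>s\<close> copies of \<open>p\<close>, and the generators of
  the source algebra exhibit \<open>p\<close> as \<open>CARD('m)\<close> copies of itself.  If \<open>p\<close> is a sum of \<open>k\<close> copies of \<open>1\<close>, the
  uniqueness of the rank modulo \<open>CARD('n) - 1\<close> gives both congruences.
\<close>

lemma matrix_hom_imp_cong:
  fixes f :: "('k::field, 'm::finite) leavitt mat \<Rightarrow> ('k, 'n::finite) leavitt mat"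
  assumes n: "1 < CARD('n)" and s: "0 < s"
    and f: "f \<in> ring_hom (ring_mat TYPE(('k, 'm) leavitt) s ()) (ring_mat TYPE(('k, 'n) leavitt) t ())"
  shows "\<exists>k. [CARD('m) * k = k] (mod (CARD('n) - 1)) \<and> [k * s = t] (mod (CARD('n) - 1))"
proof -
  note f = ring_hom_matD[OF f]
  obtain e :: "('k, 'n) leavitt" and U V where UV: "copies {..<t} 1 e U V"
    using ex_copies[OF n] by blast
  define G where "G a b x = corner U V t (f (elem_mat s a b x))" for a b x
  have G_mult: "G a b x * G c d y = G a d (if b = c then x * y else 0)" if "b < s" for a b c d x y
    using that by (simp add: G_def corner_mult[OF UV, symmetric] f(1) f(3)[symmetric]
        elem_mat_carrier elem_mat_mult)
  have G_add: "G a b (x + y) = G a b x + G a b y" for a b x y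
    by (simp add: G_def corner_add[symmetric] f(1) f(2)[symmetric] elem_mat_carrier elem_mat_add)
  have G_zero: "G a b 0 = 0" for a b using G_add[of a b 0 0] by simp
  have G_sum: "G a b (\<Sum>i\<in>A. h i) = (\<Sum>i\<in>A. G a b (h i))" for a b A and h :: "'m \<Rightarrow> _"
    by (induction A rule: infinite_finite_induct) (simp_all add: G_zero G_add)
  have "corner U V t (f (1\<^sub>m s)) = e"
    unfolding f(4) by (rule corner_diagonal[OF UV]) simp
  moreover have "corner U V t (f (1\<^sub>m s)) = (\<Sum>a<s. G a a 1)"
    unfolding G_def by (rule additive_one_mat[of s "\<lambda>X. corner U V t (f X)"]) (simp add: f corner_add)
  ultimately have G_diag: "(\<Sum>a<s. G a a 1) = e" by simp
  let ?p = "G 0 0 1"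
  have p: "copies {..<s} ?p e (\<lambda>a. G a 0 1) (\<lambda>a. G 0 a 1)"
    by (rule copiesI) (use s in \<open>auto simp: G_mult G_diag G_zero\<close>)
  have mp: "copies UNIV ?p ?p (\<lambda>j. G 0 0 (gen j)) (\<lambda>j. G 0 0 (gen_star j))"
    by (rule copiesI) (use s in \<open>auto simp: G_mult G_zero gen_star_gen G_sum[symmetric] sum_gen_gen_star\<close>)
  have "?p * ?p = ?p" using s by (simp add: G_mult)
  then obtain I :: "'n list set" and u v where I: "copies I 1 ?p u v"
    using ex_copies_of_idempotent[OF n] by blast
  have "[card ((UNIV :: 'm set) \<times> I) = card I] (mod (CARD('n) - 1))"
    using n copies_compose[OF mp I] I by (rule copies_card_cong)
  moreover have "[card ({..<s} \<times> I) = card {..<t}] (mod (CARD('n) - 1))"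
    using n copies_compose[OF p I] UV by (rule copies_card_cong)
  ultimately show ?thesis
    by (intro exI[of _ "card I"]) (simp add: card_cartesian_product mult.commute)
qed

text \<open>
  By the congruences there are an idempotent \<open>p\<close> that is the sum of \<open>k\<close> as well as of \<open>CARD('m) * k\<close>
  copies of \<open>1\<close>, hence of \<open>CARD('m)\<close> copies of itself, and an idempotent \<open>e\<close> that is the sum of \<open>t\<close> as
  well as of \<open>s * k\<close> copies of \<open>1\<close>, hence of \<open>s\<close> copies of \<open>p\<close>.  The first gives a homomorphism \<open>\<phi>\<close> to
  the corner \<open>pLp\<close>; the second identifies the \<open>s \<times> s\<close> matrices over \<open>pLp\<close> and the \<open>t \<times> t\<close> matrices over \<open>L\<close>
  with the same corner \<open>eLe\<close>.
\<close>

lemma cong_imp_matrix_hom: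
  assumes m: "1 < CARD('m::finite)" and n: "1 < CARD('n::finite)"
    and pos: "0 < s" "0 < t" "0 < k"
    and mk: "[CARD('m) * k = k] (mod (CARD('n) - 1))" and ks: "[s * k = t] (mod (CARD('n) - 1))"
  shows "\<exists>f :: ('k::field, 'm) leavitt mat \<Rightarrow> ('k, 'n) leavitt mat.
    unital_algebra_hom s t f \<and> inj_on f (carrier_mat s s)"
proof -
  obtain p :: "('k, 'n) leavitt" and u v u' v' where p: "copies {..<k} 1 p u v"
    and mp: "copies {..<CARD('m) * k} 1 p u' v'"
    using ex_copies_both[OF n cong_sym[OF mk]] pos by auto
  obtain Y Z where "copies ((UNIV :: 'm set) \<times> {..<k}) 1 p Y Z"
    using copies_card[OF mp, of "(UNIV :: 'm set) \<times> {..<k}"] by (auto simp: card_cartesian_product)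
  from copies_factor[OF this p] obtain y z :: "'m \<Rightarrow> _" where yz: "copies UNIV p p y z" by auto
  obtain \<phi> :: "('k, 'm) leavitt \<Rightarrow> ('k, 'n) leavitt" where
    \<phi>: "\<And>a b. \<phi> (a + b) = \<phi> a + \<phi> b" "\<And>a b. \<phi> (a * b) = \<phi> a * \<phi> b"
    "\<And>c a. \<phi> (leavitt_scale c a) = leavitt_scale c (\<phi> a)" "\<phi> 1 = p"
    using ex_leavitt_corner_hom[OF yz] by blast
  have "p \<noteq> 0"
  proof
    assume "p = 0"
    then have "u 0 = 0" using copies_unit_left[OF p, of 0] pos by simp
    then show False using copies_orth[OF p, of 0 0] pos by simp
  qed
  then have inj: "inj \<phi>" using leavitt_hom_inj[OF m \<phi>(1,2)] \<phi>(4) by simp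
  have \<phi>0: "\<phi> 0 = 0" using \<phi>(1)[of 0 0] by simp
  have \<phi>_sum: "\<phi> (\<Sum>i\<in>A. h i) = (\<Sum>i\<in>A. \<phi> (h i))" for A and h :: "nat \<Rightarrow> _"
    by (induction A rule: infinite_finite_induct) (simp_all add: \<phi>0 \<phi>(1))
  have p\<phi>: "p * \<phi> a = \<phi> a" "\<phi> a * p = \<phi> a" for a
    using \<phi>(2)[of 1 a] \<phi>(2)[of a 1] \<phi>(4) by simp_all

  obtain e :: "('k, 'n) leavitt" and U V U' V' where e: "copies {..<t} 1 e U V"
    and ske: "copies {..<s * k} 1 e U' V'"
    using ex_copies_both[OF n cong_sym[OF ks]] pos by auto
  obtain W W' where "copies ({..<s} \<times> {..<k}) 1 e W W'"
    using copies_card[OF ske, of "{..<s} \<times> {..<k}"] by (auto simp: card_cartesian_product)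
  from copies_factor[OF this p] obtain w w' where w: "copies {..<s} p e w w'" by auto

  define F where "F X = corner w w' s (map_mat \<phi> X)" for X
  define f where "f X = mat t t (\<lambda>(i, j). V i * F X * U j)" for X
  have map_mult: "map_mat \<phi> (X * Y) = map_mat \<phi> X * map_mat \<phi> Y"
    if "X \<in> carrier_mat s s" "Y \<in> carrier_mat s s" for X Y
    using that by (intro eq_matI) (auto simp: scalar_prod_def \<phi>_sum \<phi>(2) intro!: sum.cong)
  have F_mult: "F (X * Y) = F X * F Y" if "X \<in> carrier_mat s s" "Y \<in> carrier_mat s s" for X Y
    using that unfolding F_def map_mult[OF that] by (intro corner_mult[OF w]) (auto simp: p\<phi>)
  have F_add: "F (X + Y) = F X + F Y" if "X \<in> carrier_mat s s" "Y \<in> carrier_mat s s" for X Y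
  proof -
    have "map_mat \<phi> (X + Y) = map_mat \<phi> X + map_mat \<phi> Y"
      using that by (intro eq_matI) (auto simp: \<phi>(1))
    then show ?thesis using that by (simp add: F_def corner_add)
  qed
  have F_one: "F (1\<^sub>m s) = e"
    unfolding F_def by (rule corner_diagonal[OF w]) (simp add: \<phi>(4) \<phi>0)
  have F_scale: "F (mat_scale c X) = leavitt_scale c (F X)" if "X \<in> carrier_mat s s" for c X
    using that by (simp add: F_def corner_def mat_scale_def \<phi>(3) leavitt.scale_sum_right)
  have eF: "e * F X = F X" "F X * e = F X" for X
    using corner_unit[OF w] by (simp_all add: F_def)
  have f_mult: "f (X * Y) = f X * f Y" if "X \<in> carrier_mat s s" "Y \<in> carrier_mat s s" for X Y
  proof (rule eq_matI)
    fix i j assume "i < dim_row (f X * f Y)" "j < dim_col (f X * f Y)"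
    then have ij: "i < t" "j < t" by (simp_all add: f_def)
    then have "(f X * f Y) $$ (i, j) = (\<Sum>l<t. V i * F X * U l * (V l * F Y * U j))"
      by (simp add: f_def scalar_prod_def lessThan_atLeast0)
    also have "\<dots> = V i * F X * (\<Sum>l<t. U l * V l) * F Y * U j"
      by (simp add: sum_distrib_left sum_distrib_right mult.assoc)
    also have "\<dots> = V i * (F X * e) * F Y * U j"
      by (simp only: copies_sum[OF e] mult.assoc)
    also have "\<dots> = f (X * Y) $$ (i, j)"
      using ij that by (simp add: f_def F_mult eF mult.assoc)
    finally show "f (X * Y) $$ (i, j) = (f X * f Y) $$ (i, j)" by (rule sym)
  qed (simp_all add: f_def)
  have f_add: "f (X + Y) = f X + f Y" if "X \<in> carrier_mat s s" "Y \<in> carrier_mat s s" for X Y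
    using that by (intro eq_matI) (auto simp: f_def F_add distrib_left distrib_right)
  have f_one: "f (1\<^sub>m s) = 1\<^sub>m t"
    by (rule eq_matI)
      (auto simp: f_def F_one mult.assoc copies_unit_left[OF e] copies_orth[OF e])
  have f_scale: "f (mat_scale c X) = mat_scale c (f X)" if "X \<in> carrier_mat s s" for c X
    unfolding f_def F_scale[OF that] by (rule eq_matI) (auto simp: mat_scale_def)
  have "unital_algebra_hom s t f"
    unfolding unital_algebra_hom_def ring_hom_def
    by (auto simp: ring_mat_simps f_mult f_add f_one f_scale) (simp_all add: f_def)
  moreover have "inj_on f (carrier_mat s s)"
  proof (rule inj_onI)
    fix X Y assume XY: "X \<in> carrier_mat s s" "Y \<in> carrier_mat s s" "f X = f Y"
    have "F X = corner U V t (f X)" for X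
      unfolding f_def using corner_entries[OF e eF] by (rule sym)
    then have FXY: "F X = F Y" using XY(3) by simp
    show "X = Y"
    proof (rule eq_matI)
      fix i j assume "i < dim_row Y" "j < dim_col Y"
      then have ij: "i < s" "j < s" using XY by auto
      then have "w' i * F Z * w j = \<phi> (Z $$ (i, j))" if "Z \<in> carrier_mat s s" for Z
        using that by (simp add: F_def corner_entry[OF w] p\<phi>)
      then have "\<phi> (X $$ (i, j)) = \<phi> (Y $$ (i, j))" using FXY XY by metis
      then show "X $$ (i, j) = Y $$ (i, j)" using inj by (simp add: inj_eq)
    qed (use XY in auto)
  qed
  ultimately show ?thesis by blast
qed

theorem corollary2p4:
  fixes n m s t :: nat
  assumes "m = CARD('m::finite)" and "n = CARD('n::finite)"
    and "1 < m" and "1 < n" and "0 < s" and "0 < t"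
  shows "(\<exists>f :: ('k::field, 'm) leavitt mat \<Rightarrow> ('k, 'n) leavitt mat.
            unital_algebra_hom s t f \<and> inj_on f (carrier_mat s s)) \<longleftrightarrow>
         (\<exists>k k' :: nat. 0 < k \<and> 0 < k' \<and> (m - 1) * k = (n - 1) * k' \<and> [k * s = t] (mod (n - 1)))"
    (is "?L \<longleftrightarrow> ?R")
proof
  assume ?L
  then obtain f :: "('k, 'm) leavitt mat \<Rightarrow> ('k, 'n) leavitt mat" where
    "f \<in> ring_hom (ring_mat TYPE(('k, 'm) leavitt) s ()) (ring_mat TYPE(('k, 'n) leavitt) t ())"
    by (auto simp: unital_algebra_hom_def)
  then obtain k0 where k0: "[m * k0 = k0] (mod (n - 1))" "[k0 * s = t] (mod (n - 1))"
    using matrix_hom_imp_cong[of s f t] assms by auto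
  \<comment> \<open>The shift by n - 1 keeps the residue class and makes k positive.\<close>
  define k where "k = k0 + (n - 1)"
  have "0 < k" using assms by (simp add: k_def)
  have "[k = k0] (mod (n - 1))" by (simp add: k_def cong_def)
  then have k: "[m * k = k] (mod (n - 1))" "[k * s = t] (mod (n - 1))"
    using k0 by (meson cong_mult cong_refl cong_sym cong_trans)+
  have "k \<le> m * k" using assms by simp
  then have "(n - 1) dvd m * k - k" using k(1) by (simp add: cong_altdef_nat)
  moreover have "m * k - k = (m - 1) * k" by (simp add: diff_mult_distrib)
  ultimately obtain k' where k': "(m - 1) * k = (n - 1) * k'" by (auto elim: dvdE)
  have "0 < (m - 1) * k" using \<open>0 < k\<close> assms by simp
  then have "0 < k'" using k' by (metis gr0I mult_0_right less_irrefl)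
  with \<open>0 < k\<close> k' k(2) show ?R by blast
next
  assume ?R
  then obtain k k' where k: "0 < k" "(m - 1) * k = (n - 1) * k'" "[k * s = t] (mod (n - 1))" by blast
  have "m * k = (n - 1) * k' + k"
  proof -
    have "(m - 1) * k + k = m * k" using assms(3) by (cases m) auto
    then show ?thesis using k(2) by simp
  qed
  then have "[m * k = k] (mod (n - 1))" by (simp add: cong_def)
  with k show ?L
    using assms cong_imp_matrix_hom[where 'm = 'm and 'n = 'n and 'k = 'k, of s t k] by (simp add: mult.commute)
qed

end
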